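(* Let $\mathcal{C}$ be a clutter with vertex set $X=\{x_1,\ldots,x_n\}$, let $I=I(\mathcal{C})\subset R=K[x_1,\ldots,x_n]$ be its edge ideal, where $K$ is a field, and let $\mathcal{H}$ be the Hilbert basis of the Simis cone ${\rm Cn}(I)$. Then $$\mathcal{H}=\{(a,b)\mid x^at^b\text{ is a minimal generator of }R_s(I)\}=\{(a,\alpha_0(\mathcal{C}^a))\mid 0\neq a\in\mathbb{N}^n,\ \mathcal{C}^a\text{ is an indecomposable parallelization of }\mathcal{C}\},$$ and $R_s(I)$ is equal to the semigroup ring $K[\mathbb{N}\mathcal{H}]$ of $\mathbb{N}\mathcal{H}$.
   Context: $\mathbb{N}=\{0,1,2,\ldots\}$. A clutter $\mathcal{C}$ with finite nonempty vertex set $X=V(\mathcal{C})=\{x_1,\ldots,x_n\}$ is a family $E(\mathcal{C})$ of nonempty subsets of $X$, called edges, none of which is included in another (the family may be empty). Edge ideal: $R=K[x_1,\ldots,x_n]$ is a polynomial ring over a field $K$ (vertices are identified with variables), and $I=I(\mathcal{C})$ is the ideal of $R$ generated by the monomials $x_e=\prod_{x_i\in e}x_i$ with $e\in E(\mathcal{C})$ ($I=0$ if there are no edges). For $a=(a_1,\ldots,a_n)\in\mathbb{N}^n$, $x^a=x_1^{a_1}\cdots x_n^{a_n}$. Symbolic powers: let $\mathfrak{p}_1,\ldots,\mathfrak{p}_s$ be the minimal primes of $I$ and $S=R\setminus\bigcup_{k=1}^s\mathfrak{p}_k$. For $i\ge 1$ the $i$th symbolic power of $I$ is $I^{(i)}=S^{-1}I^i\cap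 R$; for these ideals $I^{(i)}=\mathfrak{p}_1^i\cap\cdots\cap\mathfrak{p}_s^i$. The symbolic Rees algebra of $I$ is $R_s(I)=R\oplus I^{(1)}t\oplus I^{(2)}t^2\oplus\cdots\subset R[t]$, with $t$ a new variable. $R_s(I)$ is generated as a $K$-algebra by a unique minimal finite set of monomials in $x_1,\ldots,x_n,t$; the elements of that set are called the minimal generators of $R_s(I)$. Vertex covers: a subset $C\subset V(\mathcal{C})$ is a vertex cover of $\mathcal{C}$ if every edge contains at least one vertex of $C$; it is minimal if no proper subset is a vertex cover. $\alpha_0(\mathcal{C})$ is the minimum number of vertices in a vertex cover ($\alpha_0=0$ if there are no edges). Simis cone: let $C_1,\ldots,C_s$ be the minimal vertex covers of $\mathcal{C}$ and $u_k=\sum_{x_i\in C_k}e_i\in\mathbb{R}^n$ the characteristic vector of $C_k$ for $1\le k\le s$. The Simis cone of $I$ is the pointed rational polyhedral cone $${\rm Cn}(I)=H_{e_1}^+\cap\cdots\cap H_{e_{n+1}}^+\cap H_{(u_1,-1)}^+\cap\cdots\cap H_{(u_s,-1)}^+\subset\mathbb{R}^{n+1},$$ where $H_c^+=\{x\in\mathbb{R}^{n+1}\mid\langle x,c\rangle\ge0\}$ and $e_1,\ldots,e_{n+1}$ are here the unit vectors of $\mathbb{R}^{n+1}$. Its Hilbert basis $\mathcal{H}$ is the unique minimal (with respect to inclusion) finite set $\mathcal{H}\subset\mathbb{Z}^{n+1}$ such that ${\rm Cn}(I)=\mathbb{R}_+\mathcal{H}$ and $\mathbb{Z}^{n+1}\cap\mathbb{R}_+\mathcal{H}=\mathbb{N}\mathcal{H}$,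 where $\mathbb{R}_+\mathcal{H}$ and $\mathbb{N}\mathcal{H}$ are the sets of linear combinations of $\mathcal{H}$ with coefficients in the nonnegative reals and in $\mathbb{N}$, respectively. The semigroup ring $K[\mathbb{N}\mathcal{H}]$ is the $K$-subalgebra of $R[t]$ spanned by the monomials $x^at^b$ with $(a,b)\in\mathbb{N}\mathcal{H}$. Indecomposability: for $S\subset V(\mathcal{C})$, the induced subclutter $\mathcal{C}[S]$ has vertex set $S$ and as edges exactly the edges of $\mathcal{C}$ contained in $S$. $\mathcal{C}$ is decomposable if there are nonempty disjoint sets $X_1,X_2$ with $V(\mathcal{C})=X_1\cup X_2$ and $\alpha_0(\mathcal{C})=\alpha_0(\mathcal{C}[X_1])+\alpha_0(\mathcal{C}[X_2])$; otherwise it is indecomposable. Parallelization: duplicating a vertex $x_i$ means adding a new vertex $x_i'$ and replacing the edge set $E$ by $E\cup\{(e\setminus\{x_i\})\cup\{x_i'\} : x_i\in e\in E\}$. Deleting $x_i$ means removing $x_i$ and all edges containing it. For $a\in\mathbb{N}^n$, $\mathcal{C}^a$ is the clutter obtained from $\mathcal{C}$ by deleting every vertex $x_i$ with $a_i=0$ and duplicating $a_i-1$ times every vertex $x_i$ with $a_i\geq1$. Explicitly, $\mathcal{C}^a$ has vertices $x_i^j$ (where $j$ is an index) with $1\le i\le n$, $1\le j\le a_i$, and its edges are the sets $\{x_{k_1}^{j_1},\ldots,x_{k_r}^{j_r}\}$ with $\{x_{k_1},\ldots,x_{k_r}\}$ an edge of $\mathcal{C}$ (with $r$ distinct vertices)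 and $1\le j_i\le a_{k_i}$.
   Formalization: The second equality (with indecomposable parallelizations) is stated only for clutters all of whose edges have at least two vertices; it fails whenever there is a one-vertex edge {x_i}, since then (e_i,0) is in H but α_0(C^{e_i})=1. *)

theory Defs
  imports
    "HOL-Analysis.Analysis"
    "HOL-Computational_Algebra.Polynomial"
    "HOL-Library.Poly_Mapping"
    "HOL-Algebra.Ideal_Product"
    "HOL-Algebra.Algebraic_Closure_Type"
begin

section \<open>Clutters\<close>

record 'a clutter =
  verts :: "'a set"
  edges :: "'a set set"

definition is_clutter :: "'a clutter \<Rightarrow> bool" where
  "is_clutter C \<longleftrightarrow> finite (verts C) \<and> verts C \<noteq> {} \<and>
     (\<forall>e\<in>edges C. e \<noteq> {} \<and> e \<subseteq> verts C) \<and>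
     (\<forall>e\<in>edges C. \<forall>f\<in>edges C. e \<subseteq> f \<longrightarrow> e = f)"

definition vertex_cover :: "'a clutter \<Rightarrow> 'a set \<Rightarrow> bool" where
  "vertex_cover C S \<longleftrightarrow> S \<subseteq> verts C \<and> (\<forall>e\<in>edges C. e \<inter> S \<noteq> {})"

definition minimal_vertex_cover :: "'a clutter \<Rightarrow> 'a set \<Rightarrow> bool" where
  "minimal_vertex_cover C S \<longleftrightarrow> vertex_cover C S \<and> (\<forall>T. T \<subset> S \<longrightarrow> \<not> vertex_cover C T)"

definition alpha0 :: "'a clutter \<Rightarrow> nat" where
  "alpha0 C = (LEAST k. \<exists>S. vertex_cover C S \<and> card S = k)"

definition induced_subclutter :: "'a clutter \<Rightarrow> 'a set \<Rightarrow> 'a clutter" where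
  "induced_subclutter C S = \<lparr> verts = S, edges = {e \<in> edges C. e \<subseteq> S} \<rparr>"

definition decomposable :: "'a clutter \<Rightarrow> bool" where
  "decomposable C \<longleftrightarrow> (\<exists>X1 X2. X1 \<noteq> {} \<and> X2 \<noteq> {} \<and> X1 \<inter> X2 = {} \<and> verts C = X1 \<union> X2 \<and>
     alpha0 C = alpha0 (induced_subclutter C X1) + alpha0 (induced_subclutter C X2))"

text \<open>The pair \<open>(v, j)\<close> is the \<open>j\<close>-th copy of the vertex \<open>v\<close>.  A vertex with multiplicity
  \<open>0\<close> has no copies, so every edge through it disappears.\<close>

definition parallelization :: "'a clutter \<Rightarrow> ('a \<Rightarrow>\<^sub>0 nat) \<Rightarrow> ('a \<times> nat) clutter" where
  "parallelization C a = \<lparr>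
     verts = {(v, j). v \<in> verts C \<and> 1 \<le> j \<and> j \<le> Poly_Mapping.lookup a v},
     edges = {(\<lambda>v. (v, j v)) ` e | e j. e \<in> edges C \<and> (\<forall>v\<in>e. 1 \<le> j v \<and> j v \<le> Poly_Mapping.lookup a v)} \<rparr>"


section \<open>Symbolic powers\<close>

abbreviation ideal_power :: "'a::comm_ring_1 set \<Rightarrow> nat \<Rightarrow> 'a set" where
  "ideal_power I i \<equiv> I [^]\<^bsub>ideals_set (ring_of_type_algebra :: 'a ring)\<^esub> i"

definition minimal_primes :: "'a::comm_ring_1 set \<Rightarrow> 'a set set" where
  "minimal_primes I = {P. primeideal P ring_of_type_algebra \<and> I \<subseteq> P \<and>
     (\<forall>Q. primeideal Q ring_of_type_algebra \<and> I \<subseteq> Q \<and> Q \<subseteq> P \<longrightarrow> Q = P)}"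

text \<open>With \<open>S\<close> the complement of the union of the minimal primes of \<open>I\<close>, the \<open>i\<close>-th symbolic
  power is the preimage of \<open>S\<^sup>-\<^sup>1I\<^sup>i\<close> under \<open>R \<rightarrow> S\<^sup>-\<^sup>1R\<close>.  Its condition
  \<open>u * (s * f - g) = 0\<close> says that \<open>f/1 = g/s\<close> in \<open>S\<^sup>-\<^sup>1R\<close>.\<close>

definition symbolic_power :: "'a::comm_ring_1 set \<Rightarrow> nat \<Rightarrow> 'a set" where
  "symbolic_power I i = (let S = - \<Union> (minimal_primes I) in
     {f. \<exists>g\<in>ideal_power I i. \<exists>s\<in>S. \<exists>u\<in>S. u * (s * f - g) = 0})"

definition symbolic_Rees_algebra :: "'a::comm_ring_1 set \<Rightarrow> 'a poly set" where
  "symbolic_Rees_algebra I = {p. \<forall>i\<ge>1. Polynomial.coeff p i \<in> symbolic_power I i}"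


section \<open>The polynomial rings $R = K[x_v : v]$ and $R[t]$\<close>

type_synonym ('v, 'k) mpoly = "('v \<Rightarrow>\<^sub>0 nat) \<Rightarrow>\<^sub>0 'k"

definition mpoly_var :: "'v \<Rightarrow> ('v, 'k::field) mpoly" where
  "mpoly_var v = Poly_Mapping.single (Poly_Mapping.single v 1) 1"

definition edge_ideal :: "'v clutter \<Rightarrow> ('v, 'k::field) mpoly set" where
  "edge_ideal C = Idl\<^bsub>ring_of_type_algebra\<^esub> ((\<lambda>e. \<Prod>v\<in>e. mpoly_var v) ` edges C)"

text \<open>The monomial \<open>x\<^sup>a t\<^sup>b\<close>:\<close>

definition xt_monomial :: "('v \<Rightarrow>\<^sub>0 nat) \<Rightarrow> nat \<Rightarrow> ('v, 'k::field) mpoly poly" where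
  "xt_monomial a b = Polynomial.monom (Poly_Mapping.single a 1) b"

definition K_scale :: "'k::field \<Rightarrow> ('v, 'k) mpoly poly \<Rightarrow> ('v, 'k) mpoly poly" where
  "K_scale c p = Polynomial.smult (Poly_Mapping.single 0 c) p"

global_interpretation K_vs: vector_space K_scale
  by unfold_locales
    (simp_all add: K_scale_def smult_add_right smult_add_left single_add mult_single)

definition K_subalgebra :: "('v, 'k::field) mpoly poly set \<Rightarrow> bool" where
  "K_subalgebra A \<longleftrightarrow> K_vs.subspace A \<and> 1 \<in> A \<and> (\<forall>p\<in>A. \<forall>q\<in>A. p * q \<in> A)"

definition monomial_generating_set ::
    "('v, 'k::field) mpoly poly set \<Rightarrow> ('v, 'k) mpoly poly set \<Rightarrow> bool" where
  "monomial_generating_set A M \<longleftrightarrow>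
     finite M \<and> M \<subseteq> {xt_monomial a b | a b. True} \<and> K_subalgebra hull M = A"

definition minimal_generators :: "('v, 'k::field) mpoly poly set \<Rightarrow> ('v, 'k) mpoly poly set" where
  "minimal_generators A = (THE M. monomial_generating_set A M \<and>
     (\<forall>N. N \<subset> M \<longrightarrow> \<not> monomial_generating_set A N))"


section \<open>The Simis cone and Hilbert bases\<close>

definition Hplus :: "'a::real_inner \<Rightarrow> 'a set" where
  "Hplus c = {x. x \<bullet> c \<ge> 0}"

text \<open>The space of dimension \<open>n + 1\<close>, where \<open>n = CARD('v)\<close>, is rendered as
  \<open>(real ^ 'v) \<times> real\<close>.\<close>

definition simis_cone :: "'v::finite clutter \<Rightarrow> ((real ^ 'v) \<times> real) set" where
  "simis_cone C = (\<Inter>e\<in>Basis. Hplus e) \<inter>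
     (\<Inter>S\<in>{S. minimal_vertex_cover C S}. Hplus (\<Sum>v\<in>S. axis v 1, -1))"

definition nonneg_span :: "'a::real_vector set \<Rightarrow> 'a set" where
  "nonneg_span H = {\<Sum>h\<in>F. c h *\<^sub>R h | F c. finite F \<and> F \<subseteq> H \<and> (\<forall>h\<in>F. (c h :: real) \<ge> 0)}"

definition nat_span :: "'a::real_vector set \<Rightarrow> 'a set" where
  "nat_span H = {\<Sum>h\<in>F. real (c h) *\<^sub>R h | F c. finite F \<and> F \<subseteq> H}"

definition integer_points :: "'a::euclidean_space set" where
  "integer_points = {x. \<forall>e\<in>Basis. x \<bullet> e \<in> \<int>}"

definition hilbert_generating_set :: "'a::euclidean_space set \<Rightarrow> 'a set \<Rightarrow> bool" where
  "hilbert_generating_set Q H \<longleftrightarrow> finite H \<and> H \<subseteq> integer_points \<and>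
     Q = nonneg_span H \<and> integer_points \<inter> nonneg_span H = nat_span H"

definition hilbert_basis :: "'a::euclidean_space set \<Rightarrow> 'a set" where
  "hilbert_basis Q = (THE H. hilbert_generating_set Q H \<and>
     (\<forall>G. G \<subset> H \<longrightarrow> \<not> hilbert_generating_set Q G))"

definition lattice_point :: "('v::finite \<Rightarrow>\<^sub>0 nat) \<Rightarrow> nat \<Rightarrow> (real ^ 'v) \<times> real" where
  "lattice_point a b = (\<chi> v. real (Poly_Mapping.lookup a v), real b)"

definition semigroup_ring ::
    "((real ^ 'v::finite) \<times> real) set \<Rightarrow> ('v, 'k::field) mpoly poly set" where
  "semigroup_ring N = K_vs.span {xt_monomial a b | a b. lattice_point a b \<in> N}"

end

theory Submission
  imports Defs
begin

text \<open>All three descriptions refer to the irreducible elements of the monoid of lattice points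
  \<open>(a, b)\<close> of the Simis cone, i.e. those with \<open>b \<le> |a|\<^sub>S\<close> for all minimal vertex covers \<open>S\<close>, where
  \<open>|a|\<^sub>S\<close> is the degree of \<open>x\<^sup>a\<close> in the variables of \<open>S\<close>.  By Dickson's lemma there are
  finitely many of them; they generate the monoid and lie in each of its generating sets.  The
  minimal primes of the edge ideal are generated by the minimal vertex covers, and a monomial
  \<open>x\<^sup>a\<close> lies in the \<open>i\<close>-th symbolic power iff \<open>(a, i)\<close> is in the monoid: after multiplication by
  the sum over these covers \<open>T\<close> of \<open>(\<Prod>w\<notin>T. x\<^sub>w)\<^sup>i\<close>, which avoids all minimal primes, it is in the ordinary power.
  Finally the largest \<open>b\<close> above a given \<open>a\<close> is the covering number of the parallelization, and
  splitting the copies of the vertices corresponds to decomposing \<open>a\<close>.\<close>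

section \<open>Irreducible elements of commutative monoids\<close>

text \<open>The submonoid generated by \<open>G\<close>. Adding one generator at a time replaces
  coefficient functions by an induction rule, which carries over to images under additive
  maps.\<close>

inductive_set add_closure :: "'a::comm_monoid_add set \<Rightarrow> 'a set" for G where
  zero: "0 \<in> add_closure G"
| add: "x \<in> G \<Longrightarrow> y \<in> add_closure G \<Longrightarrow> x + y \<in> add_closure G"

definition irreducibles :: "'a::comm_monoid_add set \<Rightarrow> 'a set" where
  "irreducibles M = {x \<in> M. x \<noteq> 0 \<and> (\<forall>y\<in>M. \<forall>z\<in>M. x = y + z \<longrightarrow> y = 0 \<or> z = 0)}"

lemma add_closure_incl: "G \<subseteq> add_closure G"
proof
  fix x assume "x \<in> G"
  then show "x \<in> add_closure G" using add_closure.add[OF _ add_closure.zero, of x G] by simp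
qed

lemma add_closure_plus:
  assumes "x \<in> add_closure G" "y \<in> add_closure G"
  shows "x + y \<in> add_closure G"
  using assms(1)
proof induction
  case zero
  show ?case using assms(2) by simp
next
  case (add x z)
  then show ?case by (simp add: add_closure.add add.assoc)
qed

lemma add_closure_minimal:
  assumes "G \<subseteq> M" "0 \<in> M" "\<And>x y. x \<in> M \<Longrightarrow> y \<in> M \<Longrightarrow> x + y \<in> M"
  shows "add_closure G \<subseteq> M"
proof
  fix x assume "x \<in> add_closure G"
  then show "x \<in> M" by induction (use assms in auto)
qed

lemma add_closure_image:
  assumes "f 0 = 0" "\<And>x y. f (x + y) = f x + f y"
  shows "add_closure (f ` G) = f ` add_closure G"
proof
  show "add_closure (f ` G) \<subseteq> f ` add_closure G"
  proof (rule add_closure_minimal)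
    show "f ` G \<subseteq> f ` add_closure G" using add_closure_incl by blast
    show "0 \<in> f ` add_closure G" using assms(1) add_closure.zero by force
    show "\<And>x y. x \<in> f ` add_closure G \<Longrightarrow> y \<in> f ` add_closure G \<Longrightarrow> x + y \<in> f ` add_closure G"
      by (auto simp flip: assms(2) intro: add_closure_plus)
  qed
  have "f x \<in> add_closure (f ` G)" if "x \<in> add_closure G" for x
    using that by induction (auto simp: assms intro: add_closure.intros)
  then show "f ` add_closure G \<subseteq> add_closure (f ` G)" by blast
qed

lemma irreducibles_image:
  assumes "f 0 = 0" "\<And>x y. f (x + y) = f x + f y" "inj f" "\<And>x y. x \<in> M \<Longrightarrow> y \<in> M \<Longrightarrow> x + y \<in> M"
  shows "irreducibles (f ` M) = f ` irreducibles M"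
proof -
  have z: "f x = 0 \<longleftrightarrow> x = 0" for x
    using assms(1,3) by (metis injD)
  have e: "f x = f y + f w \<longleftrightarrow> x = y + w" for x y w
    using assms(2,3) by (metis injD)
  show ?thesis unfolding irreducibles_def by (auto simp: z e; metis)
qed

text \<open>If a sum of a generator and a generated element is irreducible, one summand vanishes:
  either the sum is that generator, or the induction continues with the other summand.\<close>

lemma irreducibles_add_closure_subset: "irreducibles (add_closure G) \<subseteq> G"
proof
  fix x assume x: "x \<in> irreducibles (add_closure G)"
  then have "x \<in> add_closure G" by (simp add: irreducibles_def)
  then show "x \<in> G" using x
  proof induction
    case zero
    then show ?case by (simp add: irreducibles_def)
  next
    case (add x y)
    have "x = 0 \<or> y = 0"
      using add.prems add.hyps add_closure_incl[of G] unfolding irreducibles_def by blast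
    then show ?case using add by auto
  qed
qed

text \<open>A reducible element splits into two nonzero parts. Both are strictly smaller, because
  \<open>size\<close> is additive and vanishes only at 0, so the splitting terminates.\<close>

lemma add_closure_irreducibles:
  fixes size :: "'a::comm_monoid_add \<Rightarrow> nat" and M :: "'a set"
  assumes "0 \<in> M" "\<And>x y. x \<in> M \<Longrightarrow> y \<in> M \<Longrightarrow> x + y \<in> M"
    and add: "\<And>x y. size (x + y) = size x + size y"
    and zero: "\<And>x. size x = 0 \<Longrightarrow> x = 0"
  shows "add_closure (irreducibles M) = M"
proof
  show "add_closure (irreducibles M) \<subseteq> M"
    by (rule add_closure_minimal) (use assms in \<open>auto simp: irreducibles_def\<close>)
  show "M \<subseteq> add_closure (irreducibles M)"
  proof
    fix x assume "x \<in> M"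
    then show "x \<in> add_closure (irreducibles M)"
    proof (induction "size x" arbitrary: x rule: less_induct)
      case less
      consider "x = 0" | "x \<in> irreducibles M" | y z
        where "y \<in> M" "z \<in> M" "x = y + z" "y \<noteq> 0" "z \<noteq> 0"
        using less.prems unfolding irreducibles_def by blast
      then show ?case
      proof cases
        case 3
        then have "size y > 0" "size z > 0" using zero by blast+
        then have "size y < size x" "size z < size x" using 3 add by simp_all
        then show ?thesis using less.hyps 3 add_closure_plus by blast
      qed (use add_closure.zero add_closure_incl in auto)
    qed
  qed
qed

text \<open>A least set with property \<open>P\<close> is the only minimal one. Hilbert bases and
  minimal generators are both defined as the unique minimal generating set.\<close>

lemma the_minimal_eq:
  assumes "P A" "\<And>B. P B \<Longrightarrow> A \<subseteq> B"
  shows "(THE G. P G \<and> (\<forall>N. N \<subset> G \<longrightarrow> \<not> P N)) = A"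
  by (rule the_equality) (use assms in blast)+

section \<open>Dickson's lemma and finiteness of the set of irreducibles\<close>

text \<open>Every sequence has a monotone subsequence. A decreasing one of natural numbers is
  constant from the place where its least value \<open>m\<close> is attained.\<close>

lemma nat_incseq_subsequence:
  fixes f :: "nat \<Rightarrow> nat"
  obtains r where "strict_mono (r :: nat \<Rightarrow> nat)" "incseq (\<lambda>n. f (r n))"
proof -
  obtain r where r: "strict_mono (r :: nat \<Rightarrow> nat)" "monoseq (\<lambda>n. f (r n))"
    using seq_monosub[of f] by blast
  consider "incseq (\<lambda>n. f (r n))" | "decseq (\<lambda>n. f (r n))"
    using r(2) monoseq_iff by blast
  then show ?thesis
  proof cases
    case 1
    then show ?thesis using r that by blast
  next
    case 2
    define m where "m = (LEAST k. k \<in> Set.range (\<lambda>n. f (r n)))"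
    have "m \<in> Set.range (\<lambda>n. f (r n))" unfolding m_def by (rule LeastI_ex) blast
    then obtain n0 where n0: "m = f (r n0)" by blast
    have "f (r (n + n0)) = m" for n
    proof (rule antisym)
      show "f (r (n + n0)) \<le> m" using decseqD[OF 2, of n0 "n + n0"] n0 by simp
      show "m \<le> f (r (n + n0))" unfolding m_def by (rule Least_le) blast
    qed
    then have "incseq (\<lambda>n. f (r (n + n0)))" by (simp add: incseq_def)
    moreover have "strict_mono (\<lambda>n. r (n + n0))"
      using r(1) by (simp add: strict_mono_def)
    ultimately show ?thesis using that[of "\<lambda>n. r (n + n0)"] by blast
  qed
qed

text \<open>Coordinates are treated one after another: passing to a further subsequence keeps the
  earlier ones increasing.\<close>

lemma dickson_subsequence:
  fixes s :: "nat \<Rightarrow> 'i \<Rightarrow> nat"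
  assumes "finite I"
  shows "\<exists>r. strict_mono (r :: nat \<Rightarrow> nat) \<and> (\<forall>i\<in>I. incseq (\<lambda>n. s (r n) i))"
  using assms
proof induction
  case empty
  show ?case using strict_mono_id by auto
next
  case (insert i I)
  then obtain r where r: "strict_mono (r :: nat \<Rightarrow> nat)" "\<forall>i\<in>I. incseq (\<lambda>n. s (r n) i)" by blast
  obtain q where q: "strict_mono (q :: nat \<Rightarrow> nat)" "incseq (\<lambda>n. s (r (q n)) i)"
    by (rule nat_incseq_subsequence[of "\<lambda>n. s (r n) i"])
  have "strict_mono (\<lambda>n. r (q n))" using r(1) q(1) by (simp add: strict_mono_def)
  moreover have "incseq (\<lambda>n. s (r (q n)) j)" if "j \<in> I" for j
    using r(2) q(1) that by (auto simp: incseq_def strict_mono_less_eq)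
  ultimately show ?case using q(2) by (intro exI[of _ "\<lambda>n. r (q n)"]) auto
qed

text \<open>An infinite \<open>A\<close> contains an injective sequence, and Dickson's lemma yields
  two of its terms that are comparable in all coordinates.\<close>

lemma finite_antichain:
  fixes \<psi> :: "'a \<Rightarrow> 'i \<Rightarrow> nat"
  assumes "finite I" and anti: "\<And>x y. x \<in> A \<Longrightarrow> y \<in> A \<Longrightarrow> (\<forall>i\<in>I. \<psi> x i \<le> \<psi> y i) \<Longrightarrow> x = y"
  shows "finite A"
proof (rule ccontr)
  assume "infinite A"
  then obtain s :: "nat \<Rightarrow> 'a" where s: "inj s" "Set.range s \<subseteq> A"
    using infinite_countable_subset by blast
  obtain r :: "nat \<Rightarrow> nat" where r: "strict_mono r" "\<forall>i\<in>I. incseq (\<lambda>n. \<psi> (s (r n)) i)"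
    using dickson_subsequence[OF assms(1), of "\<lambda>n. \<psi> (s n)"] by blast
  have "\<forall>i\<in>I. \<psi> (s (r 0)) i \<le> \<psi> (s (r 1)) i" using r(2) by (auto simp: incseq_def)
  then have "s (r 0) = s (r 1)" using anti s(2) by blast
  then have "r 0 = r 1" using s(1) by (simp add: inj_eq)
  then show False using strict_monoD[OF r(1), of 0 1] by simp
qed

text \<open>By \<open>diff\<close>, comparability in the coordinates \<psi> gives a difference
  inside \<open>M\<close>; between two irreducibles this difference must be 0. So the irreducibles
  form an antichain.\<close>

lemma finite_irreducibles:
  fixes \<psi> :: "'a::comm_monoid_add \<Rightarrow> 'i \<Rightarrow> nat"
  assumes "finite I"
    and diff: "\<And>x y. x \<in> M \<Longrightarrow> y \<in> M \<Longrightarrow> (\<forall>i\<in>I. \<psi> x i \<le> \<psi> y i) \<Longrightarrow> \<exists>z\<in>M. y = x + z"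
  shows "finite (irreducibles M)"
proof (rule finite_antichain[OF assms(1)])
  fix x y assume xy: "x \<in> irreducibles M" "y \<in> irreducibles M" "\<forall>i\<in>I. \<psi> x i \<le> \<psi> y i"
  then obtain z where "z \<in> M" "y = x + z" using diff unfolding irreducibles_def by blast
  then show "x = y" using xy(1,2) unfolding irreducibles_def by fastforce
qed


section \<open>The lattice points of the Simis cone\<close>

definition set_degree :: "'v set \<Rightarrow> ('v \<Rightarrow>\<^sub>0 nat) \<Rightarrow> nat" where
  "set_degree S a = (\<Sum>v\<in>S. Poly_Mapping.lookup a v)"

lemma set_degree_add [simp]: "set_degree S (a + b) = set_degree S a + set_degree S b"
  by (simp add: set_degree_def lookup_add sum.distrib)

lemma set_degree_zero [simp]: "set_degree S 0 = 0"
  by (simp add: set_degree_def)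

lemma set_degree_single [simp]:
  "finite S \<Longrightarrow> set_degree S (Poly_Mapping.single v n) = (if v \<in> S then n else 0)"
  by (simp add: set_degree_def lookup_single when_def)

text \<open>Without edges the empty set is the only minimal cover, and the condition becomes
  \<open>b = 0\<close>.\<close>

definition simis_monoid :: "'v clutter \<Rightarrow> (('v \<Rightarrow>\<^sub>0 nat) \<times> nat) set" where
  "simis_monoid C = {(a, b). \<forall>S. minimal_vertex_cover C S \<longrightarrow> b \<le> set_degree S a}"

lemma simis_monoid_zero: "0 \<in> simis_monoid C"
  by (simp add: simis_monoid_def zero_prod_def)

lemma simis_monoid_add: "x \<in> simis_monoid C \<Longrightarrow> y \<in> simis_monoid C \<Longrightarrow> x + y \<in> simis_monoid C"
  by (auto simp: simis_monoid_def intro!: add_mono)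

lemma add_closure_irreducibles_simis_monoid:
  fixes C :: "'v::finite clutter"
  shows "add_closure (irreducibles (simis_monoid C)) = simis_monoid C"
proof (rule add_closure_irreducibles[OF simis_monoid_zero simis_monoid_add, where size = "\<lambda>(a, b). set_degree UNIV a + b"])
  fix x :: "('v \<Rightarrow>\<^sub>0 nat) \<times> nat"
  assume "(case x of (a, b) \<Rightarrow> set_degree UNIV a + b) = 0"
  then show "x = 0"
    by (auto simp: set_degree_def zero_prod_def split: prod.splits intro!: poly_mapping_eqI)
qed auto

text \<open>Adjoining the slacks of the defining inequalities as coordinates makes the monoid closed
  under those differences that are nonnegative, so that Dickson's lemma applies.\<close>

lemma finite_irreducibles_simis_monoid:
  fixes C :: "'v::finite clutter"
  shows "finite (irreducibles (simis_monoid C))"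
proof -
  \<comment> \<open>Sets that are not minimal covers receive the constant coordinate 0, so that the
    index set is a whole finite type.\<close>
  define \<psi> :: "('v \<Rightarrow>\<^sub>0 nat) \<times> nat \<Rightarrow> 'v option + 'v set \<Rightarrow> nat" where
    "\<psi> = (\<lambda>(a, b) i. case i of Inl None \<Rightarrow> b | Inl (Some v) \<Rightarrow> Poly_Mapping.lookup a v
       | Inr S \<Rightarrow> if minimal_vertex_cover C S then set_degree S a - b else 0)"
  show ?thesis
  proof (rule finite_irreducibles[of UNIV _ \<psi>])
    fix x y assume M: "x \<in> simis_monoid C" "y \<in> simis_monoid C" and le: "\<forall>i\<in>UNIV. \<psi> x i \<le> \<psi> y i"
    obtain a b a' b' where xy: "x = (a, b)" "y = (a', b')" by (cases x, cases y)
    have b: "b \<le> b'" using bspec[OF le, of "Inl None"] xy by (simp add: \<psi>_def)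
    have a: "Poly_Mapping.lookup a v \<le> Poly_Mapping.lookup a' v" for v
      using bspec[OF le, of "Inl (Some v)"] xy by (simp add: \<psi>_def)
    have a': "a' = a + (a' - a)"
      by (rule poly_mapping_eqI) (simp add: lookup_add lookup_minus a)
    have "b' - b \<le> set_degree S (a' - a)" if S: "minimal_vertex_cover C S" for S
    proof -
      have "set_degree S a - b \<le> set_degree S a' - b'"
        using bspec[OF le, of "Inr S"] xy S by (simp add: \<psi>_def)
      \<comment> \<open>Because of these inequalities the truncated differences in \<psi> are the
        true slacks.\<close>
      moreover have "b \<le> set_degree S a" "b' \<le> set_degree S a'"
        using M S xy by (auto simp: simis_monoid_def)
      moreover have "set_degree S a' = set_degree S a + set_degree S (a' - a)"
        using a' set_degree_add by metis
      ultimately show ?thesis using b by linarith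
    qed
    then have "(a' - a, b' - b) \<in> simis_monoid C" by (simp add: simis_monoid_def)
    moreover have "y = x + (a' - a, b' - b)" using a' b xy by simp
    ultimately show "\<exists>z\<in>simis_monoid C. y = x + z" by blast
  qed simp
qed

section \<open>The Hilbert basis of the Simis cone\<close>

lemma nonneg_span_finite:
  assumes "finite H"
  shows "nonneg_span H = {\<Sum>h\<in>H. c h *\<^sub>R h | c. \<forall>h\<in>H. (c h :: real) \<ge> 0}"
proof (intro equalityI subsetI)
  fix x assume "x \<in> nonneg_span H"
  then obtain F c where F: "F \<subseteq> H" "\<forall>h\<in>F. (c h :: real) \<ge> 0" "x = (\<Sum>h\<in>F. c h *\<^sub>R h)"
    unfolding nonneg_span_def by blast
  have "x = (\<Sum>h\<in>H. (if h \<in> F then c h else 0) *\<^sub>R h)"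
    unfolding F(3) by (rule sum.mono_neutral_cong_left) (use assms F in auto)
  then show "x \<in> {\<Sum>h\<in>H. c h *\<^sub>R h | c. \<forall>h\<in>H. (c h :: real) \<ge> 0}"
    using F(2) by (intro CollectI exI[of _ "\<lambda>h. if h \<in> F then c h else 0"]) simp
next
  fix x assume "x \<in> {\<Sum>h\<in>H. c h *\<^sub>R h | c. \<forall>h\<in>H. (c h :: real) \<ge> 0}"
  then show "x \<in> nonneg_span H" unfolding nonneg_span_def using assms by blast
qed

text \<open>Gives access to the theory of convex cones, in particular to the closedness of finitely
  generated ones.\<close>

lemma nonneg_span_eq_convex_cone_hull:
  assumes "finite H"
  shows "nonneg_span H = convex_cone hull H"
proof
  show "nonneg_span H \<subseteq> convex_cone hull H"
  proof
    fix x assume "x \<in> nonneg_span H"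
    then obtain c where c: "\<forall>h\<in>H. (c h :: real) \<ge> 0" "x = (\<Sum>h\<in>H. c h *\<^sub>R h)"
      unfolding nonneg_span_finite[OF assms] by blast
    have "(\<Sum>h\<in>F. c h *\<^sub>R h) \<in> convex_cone hull H" if "F \<subseteq> H" for F
      using finite_subset[OF that assms] that
      by (induction F) (simp_all add: convex_cone_hull_contains_0 c(1)
          convex_cone_hull_add convex_cone_hull_mul hull_inc)
    then show "x \<in> convex_cone hull H" using c(2) by blast
  qed
  have "convex_cone (nonneg_span H)"
    unfolding convex_cone_iff
  proof (intro conjI ballI allI impI)
    show "0 \<in> nonneg_span H" unfolding nonneg_span_finite[OF assms]
      by (rule CollectI) (intro exI[of _ "\<lambda>_. 0"], simp)
  next
    fix x y assume "x \<in> nonneg_span H" "y \<in> nonneg_span H"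
    then obtain c d where "\<forall>h\<in>H. (c h :: real) \<ge> 0" "x = (\<Sum>h\<in>H. c h *\<^sub>R h)"
        "\<forall>h\<in>H. (d h :: real) \<ge> 0" "y = (\<Sum>h\<in>H. d h *\<^sub>R h)"
      unfolding nonneg_span_finite[OF assms] by blast
    then show "x + y \<in> nonneg_span H" unfolding nonneg_span_finite[OF assms]
      by (intro CollectI exI[of _ "\<lambda>h. c h + d h"]) (simp add: scaleR_add_left sum.distrib)
  next
    fix x and k :: real assume "x \<in> nonneg_span H" "0 \<le> k"
    then obtain c where "\<forall>h\<in>H. (c h :: real) \<ge> 0" "x = (\<Sum>h\<in>H. c h *\<^sub>R h)"
      unfolding nonneg_span_finite[OF assms] by blast
    then show "k *\<^sub>R x \<in> nonneg_span H" unfolding nonneg_span_finite[OF assms] using \<open>0 \<le> k\<close>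
      by (intro CollectI exI[of _ "\<lambda>h. k * c h"]) (simp add: scaleR_sum_right)
  qed
  moreover have "H \<subseteq> nonneg_span H"
  proof
    fix h assume "h \<in> H"
    then have "h = (\<Sum>h'\<in>H. (if h' = h then 1 else 0) *\<^sub>R h')"
      using assms by (simp add: if_distrib[of "\<lambda>x. x *\<^sub>R _"] cong: if_cong)
    then show "h \<in> nonneg_span H"
      unfolding nonneg_span_finite[OF assms]
        by (intro CollectI exI[of _ "\<lambda>h'. if h' = h then 1 else 0"]) simp
  qed
  ultimately show "convex_cone hull H \<subseteq> nonneg_span H" by (simp add: hull_minimal)
qed

lemma nat_span_eq_add_closure:
  assumes "finite H"
  shows "nat_span H = add_closure H"
proof
  show "nat_span H \<subseteq> add_closure H"
  proof
    fix x assume "x \<in> nat_span H"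
    then obtain F c where F: "finite F" "F \<subseteq> H" "x = (\<Sum>h\<in>F. real (c h) *\<^sub>R h)"
      unfolding nat_span_def by blast
    have *: "real n *\<^sub>R h \<in> add_closure H" if "h \<in> H" for n h
    proof (induction n)
      case (Suc n)
      then show ?case using that by (simp add: scaleR_add_left add_closure.add)
    qed (simp add: add_closure.zero)
    show "x \<in> add_closure H" unfolding F(3) using F(1,2)
      by (induction F) (auto simp: add_closure.zero intro!: add_closure_plus *)
  qed
  \<comment> \<open>Coefficients are extended by 0 to all of \<open>H\<close>, so that two
    combinations can be added coefficientwise.\<close>
  have fin: "nat_span H = {\<Sum>h\<in>H. real (c h) *\<^sub>R h | c. True}"
  proof (intro equalityI subsetI)
    fix x assume "x \<in> nat_span H"
    then obtain F c where F: "F \<subseteq> H" "x = (\<Sum>h\<in>F. real (c h) *\<^sub>R h)"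
      unfolding nat_span_def by blast
    have "x = (\<Sum>h\<in>H. real (if h \<in> F then c h else 0) *\<^sub>R h)"
      unfolding F(2) by (rule sum.mono_neutral_cong_left) (use assms F in auto)
    then show "x \<in> {\<Sum>h\<in>H. real (c h) *\<^sub>R h | c. True}" 
      by (intro CollectI exI[of _ "\<lambda>h. if h \<in> F then c h else 0"]) simp
  qed (use assms in \<open>auto simp: nat_span_def\<close>)
  show "add_closure H \<subseteq> nat_span H"
  proof (rule add_closure_minimal)
    show "H \<subseteq> nat_span H"
    proof
      fix h assume "h \<in> H"
      then have "h = (\<Sum>h'\<in>{h}. real 1 *\<^sub>R h')" by simp
      then show "h \<in> nat_span H" unfolding nat_span_def using \<open>h \<in> H\<close>
        by (intro CollectI exI[of _ "{h}"] exI[of _ "\<lambda>_. 1"]) simp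
    qed
    show "0 \<in> nat_span H" unfolding fin by (intro CollectI exI[of _ "\<lambda>_. 0"]) simp
    fix x y assume "x \<in> nat_span H" "y \<in> nat_span H"
    then obtain c d where "x = (\<Sum>h\<in>H. real (c h) *\<^sub>R h)" "y = (\<Sum>h\<in>H. real (d h) *\<^sub>R h)"
      unfolding fin by blast
    then show "x + y \<in> nat_span H" unfolding fin
      by (intro CollectI exI[of _ "\<lambda>h. c h + d h"]) (simp add: scaleR_add_left sum.distrib)
  qed
qed

lemma ball_Basis_vec_prod:
  "(\<forall>e\<in>(Basis :: ((real ^ 'v::finite) \<times> real) set). P e) \<longleftrightarrow> (\<forall>v. P (axis v 1, 0)) \<and> P (0, 1)"
  unfolding Basis_prod_def Basis_vec_def by (simp add: ball_Un ball_UN Ball_image_comp conj_commute)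

lemma integer_points_vec_prod:
  fixes x :: "(real ^ 'v::finite) \<times> real"
  shows "x \<in> integer_points \<longleftrightarrow> (\<forall>v. vec_nth (fst x) v \<in> \<int>) \<and> snd x \<in> \<int>"
  by (cases x) (simp add: integer_points_def ball_Basis_vec_prod inner_axis)

lemma simis_cone_iff:
  fixes x :: "(real ^ 'v::finite) \<times> real"
  shows "x \<in> simis_cone C \<longleftrightarrow> (\<forall>v. vec_nth (fst x) v \<ge> 0) \<and> snd x \<ge> 0 \<and>
    (\<forall>S. minimal_vertex_cover C S \<longrightarrow> snd x \<le> (\<Sum>v\<in>S. vec_nth (fst x) v))"
  by (cases x) (simp add: simis_cone_def Hplus_def ball_Basis_vec_prod inner_axis inner_sum_right)

abbreviation lattice_map :: "('v::finite \<Rightarrow>\<^sub>0 nat) \<times> nat \<Rightarrow> (real ^ 'v) \<times> real" where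
  "lattice_map \<equiv> case_prod lattice_point"

lemma lattice_map_zero: "lattice_map 0 = 0"
  by (simp add: lattice_point_def zero_prod_def vec_eq_iff)

lemma lattice_map_add: "lattice_map (x + y) = lattice_map x + lattice_map y"
  by (simp add: lattice_point_def split_beta vec_eq_iff lookup_add)

lemma inj_lattice_map: "inj lattice_map"
  by (auto simp: inj_def lattice_point_def vec_eq_iff intro: poly_mapping_eqI)

text \<open>The unit vectors among the defining functionals force nonnegative coordinates, so the
  integral ones are natural numbers; the other functionals are the inequalities of the
  monoid.\<close>

lemma integer_points_simis_cone:
  "integer_points \<inter> simis_cone C = lattice_map ` simis_monoid C"
proof (intro equalityI subsetI)
  fix x assume x: "x \<in> integer_points \<inter> simis_cone C"
  define a where "a = Abs_poly_mapping (\<lambda>v. nat \<lfloor>vec_nth (fst x) v\<rfloor>)"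
  define b where "b = nat \<lfloor>snd x\<rfloor>"
  have int: "r \<in> \<int> \<Longrightarrow> 0 \<le> r \<Longrightarrow> real (nat \<lfloor>r\<rfloor>) = r" for r :: real
    by (auto elim!: Ints_cases)
  have a: "real (Poly_Mapping.lookup a v) = vec_nth (fst x) v" for v
    using x by (simp add: a_def integer_points_vec_prod simis_cone_iff int)
  have b: "real b = snd x"
    using x by (simp add: b_def integer_points_vec_prod simis_cone_iff int)
  have "x = lattice_map (a, b)" by (simp add: lattice_point_def a b)
  moreover have "(a, b) \<in> simis_monoid C"
  proof -
    have "b \<le> set_degree S a" if "minimal_vertex_cover C S" for S
    proof -
      have "real b \<le> real (set_degree S a)"
        using x that by (simp add: simis_cone_iff a b set_degree_def)
      then show ?thesis by simp
    qed
    then show ?thesis by (simp add: simis_monoid_def)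
  qed
  ultimately show "x \<in> lattice_map ` simis_monoid C" by blast
next
  fix x :: "(real ^ 'a) \<times> real" assume "x \<in> lattice_map ` simis_monoid C"
  then obtain a b where ab: "(a, b) \<in> simis_monoid C" "x = lattice_point a b" by force
  have "real b \<le> (\<Sum>v\<in>S. real (Poly_Mapping.lookup a v))" if "minimal_vertex_cover C S" for S
  proof -
    have "real b \<le> real (set_degree S a)" using ab that by (simp add: simis_monoid_def)
    then show ?thesis by (simp add: set_degree_def)
  qed
  then show "x \<in> integer_points \<inter> simis_cone C"
    using ab by (simp add: integer_points_vec_prod simis_cone_iff lattice_point_def)
qed

text \<open>Rounding up the first component and rounding down the second one does not leave the cone,
  so the rational points of the cone are dense in it.\<close>

lemma simis_cone_subset_closed_cone:
  assumes "closed Q" "convex_cone Q" "integer_points \<inter> simis_cone C \<subseteq> Q"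
  shows "simis_cone C \<subseteq> Q"
proof
  fix x assume x: "x \<in> simis_cone C"
  \<comment> \<open>The multiple of \<open>x\<close> by \<open>Suc m\<close>, rounded to a lattice
    point. Division by \<open>Suc m\<close> then gives rational points of the cone that tend to
    \<open>x\<close>.\<close>
  define y :: "nat \<Rightarrow> (real ^ 'a) \<times> real" where
    "y m = (\<chi> v. of_int \<lceil>real (Suc m) * vec_nth (fst x) v\<rceil>, of_int \<lfloor>real (Suc m) * snd x\<rfloor>)" for m
  have "y m \<in> integer_points \<inter> simis_cone C" for m
  proof -
    have "of_int \<lfloor>real (Suc m) * snd x\<rfloor> \<le> (\<Sum>v\<in>S. real_of_int \<lceil>real (Suc m) * vec_nth (fst x) v\<rceil>)"
      if "minimal_vertex_cover C S" for S
    proof -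
      have "of_int \<lfloor>real (Suc m) * snd x\<rfloor> \<le> real (Suc m) * snd x" by simp
      also have "\<dots> \<le> real (Suc m) * (\<Sum>v\<in>S. vec_nth (fst x) v)"
        using x that by (intro mult_left_mono) (simp_all add: simis_cone_iff)
      also have "\<dots> \<le> (\<Sum>v\<in>S. real_of_int \<lceil>real (Suc m) * vec_nth (fst x) v\<rceil>)"
        unfolding sum_distrib_left by (rule sum_mono) simp
      finally show ?thesis .
    qed
    moreover have "0 \<le> \<lceil>real (Suc m) * vec_nth (fst x) v\<rceil>" for v
    proof -
      have "0 \<le> real (Suc m) * vec_nth (fst x) v" using x by (simp add: simis_cone_iff)
      then show ?thesis by linarith
    qed
    moreover have "0 \<le> snd x" using x by (simp add: simis_cone_iff)
    ultimately show ?thesis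
      by (simp add: integer_points_vec_prod simis_cone_iff y_def del: of_nat_Suc)
  qed
  then have "(1 / real (Suc m)) *\<^sub>R y m \<in> Q" for m
    using assms(2,3) by (intro convex_cone_scaleR) auto
  moreover have "(\<lambda>m. (1 / real (Suc m)) *\<^sub>R y m) \<longlonglongrightarrow> x"
  proof -
    \<comment> \<open>Rounding moves a number by at most 1, so after the division the error is at
      most \<open>1 / Suc m\<close>.\<close>
    have round: "(\<lambda>m. g (real (Suc m) * r) / real (Suc m)) \<longlonglongrightarrow> r"
      if g: "\<And>z. \<bar>g z - z\<bar> \<le> 1" for g :: "real \<Rightarrow> real" and r
    proof (rule LIM_zero_cancel, rule Lim_null_comparison[OF always_eventually LIMSEQ_inverse_real_of_nat], rule allI)
      fix m
      have "g (real (Suc m) * r) / real (Suc m) - r = (g (real (Suc m) * r) - real (Suc m) * r) / real (Suc m)"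
        by (simp add: field_simps del: of_nat_Suc)
      then show "norm (g (real (Suc m) * r) / real (Suc m) - r) \<le> inverse (real (Suc m))"
        using divide_right_mono[OF g, of "real (Suc m)" "real (Suc m) * r"]
        by (simp add: inverse_eq_divide abs_divide del: of_nat_Suc)
    qed
    have up: "\<bar>of_int \<lceil>z\<rceil> - z\<bar> \<le> 1" and down: "\<bar>of_int \<lfloor>z\<rfloor> - z\<bar> \<le> 1" for z :: real
      by linarith+
    have "(\<lambda>m. fst ((1 / real (Suc m)) *\<^sub>R y m)) \<longlonglongrightarrow> fst x"
      using round[of "\<lambda>z. of_int \<lceil>z\<rceil>", OF up]
        by (intro vec_tendstoI) (simp add: y_def del: of_nat_Suc)
    moreover have "(\<lambda>m. snd ((1 / real (Suc m)) *\<^sub>R y m)) \<longlonglongrightarrow> snd x"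
      using round[of "\<lambda>z. of_int \<lfloor>z\<rfloor>", OF down] by (simp add: y_def del: of_nat_Suc)
    ultimately have "(\<lambda>m. (fst ((1 / real (Suc m)) *\<^sub>R y m), snd ((1 / real (Suc m)) *\<^sub>R y m))) \<longlonglongrightarrow> (fst x, snd x)"
      by (rule tendsto_Pair)
    then show ?thesis unfolding prod.collapse .
  qed
  ultimately show "x \<in> Q" by (rule closed_sequentially[OF assms(1)])
qed

lemma convex_cone_simis_cone: "convex_cone (simis_cone C)"
proof -
  have "convex_cone (Hplus c)" for c :: "(real ^ 'a) \<times> real"
    using convex_cone_halfspace_ge[of c] by (simp add: Hplus_def inner_commute)
  then have "convex_cone (\<Inter>(Hplus ` A))" for A :: "((real ^ 'a) \<times> real) set"
    by (intro convex_cone_Inter) auto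
  from this[of "Basis \<union> (\<lambda>S. (\<Sum>v\<in>S. axis v 1, -1)) ` {S. minimal_vertex_cover C S}"]
  show ?thesis by (simp add: simis_cone_def image_Un image_image Inf_union_distrib)
qed

text \<open>The condition on the real cone follows from the one on lattice points: a finite
  \<open>G\<close> spans a closed convex cone, and a closed convex cone that contains all lattice
  points of the Simis cone contains the whole Simis cone.\<close>

lemma hilbert_generating_set_simis_cone_iff:
  "hilbert_generating_set (simis_cone C) G \<longleftrightarrow>
    finite G \<and> add_closure G = lattice_map ` simis_monoid C"
proof
  assume "hilbert_generating_set (simis_cone C) G"
  then show "finite G \<and> add_closure G = lattice_map ` simis_monoid C"
    by (metis hilbert_generating_set_def integer_points_simis_cone nat_span_eq_add_closure)
next
  assume G: "finite G \<and> add_closure G = lattice_map ` simis_monoid C"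
  then have sub: "G \<subseteq> integer_points \<inter> simis_cone C"
    using add_closure_incl integer_points_simis_cone by metis
  have span: "nonneg_span G = convex_cone hull G" using G nonneg_span_eq_convex_cone_hull by blast
  have "add_closure G \<subseteq> nonneg_span G"
    unfolding span by (rule add_closure_minimal)
      (auto simp: hull_inc convex_cone_hull_contains_0 convex_cone_hull_add)
  then have "simis_cone C \<subseteq> nonneg_span G"
    using G integer_points_simis_cone[of C] unfolding span
    by (intro simis_cone_subset_closed_cone closed_convex_cone_hull convex_cone_convex_cone_hull) auto
  moreover have "nonneg_span G \<subseteq> simis_cone C"
    unfolding span using sub convex_cone_simis_cone by (intro hull_minimal) auto
  ultimately have "simis_cone C = nonneg_span G" by blast
  then show "hilbert_generating_set (simis_cone C) G"
    using G sub
      by (metis hilbert_generating_set_def integer_points_simis_cone le_inf_iff nat_span_eq_add_closure)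
qed

text \<open>The irreducibles generate the monoid and lie in each of its generating sets, hence are
  the least one; the injective additive \<open>lattice_map\<close> preserves this.\<close>

lemma hilbert_basis_simis_cone:
  "hilbert_basis (simis_cone C) = lattice_map ` irreducibles (simis_monoid C)"
  unfolding hilbert_basis_def
proof (rule the_minimal_eq)
  show "hilbert_generating_set (simis_cone C) (lattice_map ` irreducibles (simis_monoid C))"
    using add_closure_image[of lattice_map "irreducibles (simis_monoid C)", OF lattice_map_zero lattice_map_add]
    by (simp add: hilbert_generating_set_simis_cone_iff finite_irreducibles_simis_monoid
        add_closure_irreducibles_simis_monoid)
next
  fix G assume "hilbert_generating_set (simis_cone C) G"
  then have "add_closure G = lattice_map ` simis_monoid C"
    by (simp add: hilbert_generating_set_simis_cone_iff)
  then show "lattice_map ` irreducibles (simis_monoid C) \<subseteq> G"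
    using irreducibles_add_closure_subset[of G]
      irreducibles_image[of lattice_map "simis_monoid C"]
    by (simp add: lattice_map_zero lattice_map_add inj_lattice_map simis_monoid_add)
qed

section \<open>Monomial subalgebras\<close>

abbreviation exponent_monomial :: "('v \<Rightarrow>\<^sub>0 nat) \<times> nat \<Rightarrow> ('v, 'k::field) mpoly poly" where
  "exponent_monomial \<equiv> case_prod xt_monomial"

lemma exponent_monomial_zero: "exponent_monomial 0 = 1"
  by (simp add: xt_monomial_def zero_prod_def monom_0)

lemma exponent_monomial_add: "exponent_monomial (x + y) = exponent_monomial x * exponent_monomial y"
  by (simp add: xt_monomial_def split_beta mult_monom mult_single)

lemma xt_monomial_eq_iff:
  "(xt_monomial a b :: ('v, 'k::field) mpoly poly) = xt_monomial c d \<longleftrightarrow> a = c \<and> b = d"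
proof
  assume eq: "(xt_monomial a b :: ('v, 'k) mpoly poly) = xt_monomial c d"
  have ne: "Poly_Mapping.single e (1::'k) \<noteq> 0" for e :: "'v \<Rightarrow>\<^sub>0 nat"
    by (metis keys_single keys_zero insert_not_empty one_neq_zero)
  have "Poly_Mapping.single a (1::'k) = Poly_Mapping.single c 1 \<and> b = d"
    using eq ne by (simp add: xt_monomial_def monom_eq_iff')
  then have eq: "Poly_Mapping.single a (1::'k) = Poly_Mapping.single c 1" and "b = d" by simp_all
  have "Poly_Mapping.keys (Poly_Mapping.single a (1::'k)) = Poly_Mapping.keys (Poly_Mapping.single c (1::'k))"
    unfolding eq ..
  then show "a = c \<and> b = d" using \<open>b = d\<close> by simp
qed simp

lemma poly_mapping_sum_single: "(\<Sum>a\<in>Poly_Mapping.keys q. Poly_Mapping.single a (Poly_Mapping.lookup q a)) = q"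
  by (rule poly_mapping_eqI) (auto simp: lookup_sum lookup_single when_def in_keys_iff)

lemma K_scale_xt_monomial: "K_scale c (xt_monomial a b) = Polynomial.monom (Poly_Mapping.single a c) b"
  by (simp add: K_scale_def xt_monomial_def smult_monom mult_single)

text \<open>A polynomial is the sum of its terms, so membership in a span of monomials depends only
  on the exponents that occur.\<close>

lemma span_exponent_monomials:
  "K_vs.span (exponent_monomial ` N) = {p. \<forall>i. \<forall>a\<in>Poly_Mapping.keys (Polynomial.coeff p i). (a, i) \<in> N}"
  (is "_ = ?A")
proof
  have "K_vs.subspace ?A"
  proof (rule K_vs.subspaceI)
    fix p q assume "p \<in> ?A" "q \<in> ?A"
    then show "p + q \<in> ?A" using Poly_Mapping.keys_add by fastforce
  next
    fix c p assume "p \<in> ?A"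
    then show "K_scale c p \<in> ?A"
      using keys_mult[of "Poly_Mapping.single 0 c"]
        by (fastforce simp: K_scale_def split: if_splits)
  qed simp
  moreover have "exponent_monomial ` N \<subseteq> ?A"
    by (auto simp: xt_monomial_def split: if_splits)
  ultimately show "K_vs.span (exponent_monomial ` N) \<subseteq> ?A"
    by (rule K_vs.span_minimal[rotated])
  show "?A \<subseteq> K_vs.span (exponent_monomial ` N)"
  proof
    fix p assume p: "p \<in> ?A"
    have "p = (\<Sum>i\<le>Polynomial.degree p. Polynomial.monom (Polynomial.coeff p i) i)"
      by (simp add: poly_as_sum_of_monoms)
    also have "\<dots> = (\<Sum>i\<le>Polynomial.degree p. \<Sum>a\<in>Poly_Mapping.keys (Polynomial.coeff p i).
        K_scale (Poly_Mapping.lookup (Polynomial.coeff p i) a) (xt_monomial a i))"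
      unfolding K_scale_xt_monomial by (simp flip: monom_sum add: poly_mapping_sum_single)
    also have "\<dots> \<in> K_vs.span (exponent_monomial ` N)"
      using p by (intro K_vs.span_sum K_vs.span_scale K_vs.span_base) force
    finally show "p \<in> K_vs.span (exponent_monomial ` N)" .
  qed
qed

lemma exponent_monomial_in_span_iff:
  "exponent_monomial x \<in> K_vs.span (exponent_monomial ` N) \<longleftrightarrow> x \<in> N"
  by (cases x) (auto simp: span_exponent_monomials xt_monomial_def split: if_splits)

text \<open>Every exponent of a product is a sum of exponents of the factors. Hence the span of the
  monomials over the generated submonoid is closed under products.\<close>

lemma K_subalgebra_hull_monomials:
  fixes G :: "(('v \<Rightarrow>\<^sub>0 nat) \<times> nat) set"
  shows "K_subalgebra hull ((exponent_monomial :: _ \<Rightarrow> ('v, 'k::field) mpoly poly) ` G) =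
    K_vs.span (exponent_monomial ` add_closure G)"
proof
  let ?A = "K_vs.span (exponent_monomial ` add_closure G) :: ('v, 'k) mpoly poly set"
  have "p * q \<in> ?A" if p: "p \<in> ?A" and q: "q \<in> ?A" for p q
  proof -
    have "(a, i) \<in> add_closure G" if "a \<in> Poly_Mapping.keys (Polynomial.coeff (p * q) i)" for a i
    proof -
      have "(\<Sum>j\<le>i. Poly_Mapping.lookup (Polynomial.coeff p j * Polynomial.coeff q (i - j)) a) \<noteq> 0"
        using that by (simp add: coeff_mult in_keys_iff lookup_sum)
      then obtain j
        where j: "j \<le> i" "a \<in> Poly_Mapping.keys (Polynomial.coeff p j * Polynomial.coeff q (i - j))"
        by (metis (no_types, lifting) atMost_iff in_keys_iff sum.not_neutral_contains_not_neutral)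
      then obtain b c where "a = b + c" "b \<in> Poly_Mapping.keys (Polynomial.coeff p j)"
          "c \<in> Poly_Mapping.keys (Polynomial.coeff q (i - j))"
        using keys_mult by blast
      then show ?thesis
        using p q j(1) add_closure_plus[of "(b, j)" G "(c, i - j)"]
          by (simp add: span_exponent_monomials)
    qed
    then show ?thesis by (simp add: span_exponent_monomials)
  qed
  moreover have "1 \<in> ?A"
    using exponent_monomial_in_span_iff[of 0 "add_closure G", where 'b = 'k]
      by (simp add: exponent_monomial_zero add_closure.zero)
  ultimately have "K_subalgebra ?A" unfolding K_subalgebra_def by blast
  then show "K_subalgebra hull (exponent_monomial ` G) \<subseteq> ?A"
    by (intro hull_minimal) (use add_closure_incl in \<open>blast intro: K_vs.span_base\<close>)
  show "?A \<subseteq> K_subalgebra hull (exponent_monomial ` G)"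
    unfolding hull_def
  proof (rule Inter_greatest, clarify)
    fix A :: "('v, 'k) mpoly poly set" and p
    assume A: "K_subalgebra A" "exponent_monomial ` G \<subseteq> A" and p: "p \<in> ?A"
    have "add_closure G \<subseteq> {x. exponent_monomial x \<in> A}"
    proof (rule add_closure_minimal)
      show "G \<subseteq> {x. exponent_monomial x \<in> A}" using A(2) by blast
      show "0 \<in> {x. exponent_monomial x \<in> A}"
        using A(1) exponent_monomial_zero by (metis K_subalgebra_def mem_Collect_eq)
      show "\<And>x y. x \<in> {x. exponent_monomial x \<in> A} \<Longrightarrow> y \<in> {x. exponent_monomial x \<in> A} \<Longrightarrow>
          x + y \<in> {x. exponent_monomial x \<in> A}"
        using A(1) exponent_monomial_add unfolding K_subalgebra_def by (metis mem_Collect_eq)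
    qed
    then have "?A \<subseteq> A" using A(1) by (intro K_vs.span_minimal) (auto simp: K_subalgebra_def)
    then show "p \<in> A" using p by blast
  qed
qed

lemma minimal_generators_span_monomials:
  assumes "finite (irreducibles N)" "add_closure (irreducibles N) = N"
  shows "minimal_generators (K_vs.span (exponent_monomial ` N) :: ('v, 'k::field) mpoly poly set) =
    exponent_monomial ` irreducibles N"
  unfolding minimal_generators_def
proof (rule the_minimal_eq)
  show "monomial_generating_set (K_vs.span (exponent_monomial ` N) :: ('v, 'k) mpoly poly set)
      (exponent_monomial ` irreducibles N)"
    using assms by (auto simp: monomial_generating_set_def K_subalgebra_hull_monomials)
next
  fix M :: "('v, 'k) mpoly poly set" assume M: "monomial_generating_set (K_vs.span (exponent_monomial ` N)) M"
  define G where "G = {x. (exponent_monomial x :: ('v, 'k) mpoly poly) \<in> M}"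
  have MG: "M = exponent_monomial ` G"
    using M by (force simp: G_def monomial_generating_set_def)
  have "K_vs.span (exponent_monomial ` add_closure G) = (K_vs.span (exponent_monomial ` N) :: ('v, 'k) mpoly poly set)"
    using M unfolding MG monomial_generating_set_def K_subalgebra_hull_monomials by simp
  \<comment> \<open>The span determines its set of exponents, so generating the algebra means
    generating the monoid.\<close>
  then have "add_closure G = N"
    using exponent_monomial_in_span_iff[where 'b = 'k] by blast
  then show "exponent_monomial ` irreducibles N \<subseteq> M"
    using irreducibles_add_closure_subset[of G] MG by auto
qed

section \<open>Ideals of the polynomial ring\<close>

abbreviation type_ring :: "'a::comm_ring_1 ring" where
  "type_ring \<equiv> ring_of_type_algebra"

lemma ring_type_ring: "ring (type_ring :: 'a::comm_ring_1 ring)"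
  and cring_type_ring: "cring (type_ring :: 'a::comm_ring_1 ring)"
  using comm_ring_1_class.ring_from_type_algebra comm_ring_1_class.cring_from_type_algebra by blast+

lemma type_ring_simps [simp]:
  "carrier type_ring = UNIV" "x \<otimes>\<^bsub>type_ring\<^esub> y = x * y" "x \<oplus>\<^bsub>type_ring\<^esub> y = x + y"
  "\<zero>\<^bsub>type_ring\<^esub> = 0" "\<one>\<^bsub>type_ring\<^esub> = 1"
  by (simp_all add: ring_of_type_algebra_def)

text \<open>Negatives are multiples by \<open>-1\<close> and multiplication commutes, so three
  closure conditions suffice.\<close>

lemma ideal_type_ring_iff:
  fixes J :: "'a::comm_ring_1 set"
  shows "ideal J type_ring \<longleftrightarrow> 0 \<in> J \<and> (\<forall>x\<in>J. \<forall>y\<in>J. x + y \<in> J) \<and> (\<forall>r. \<forall>x\<in>J. r * x \<in> J)"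
proof
  assume J: "ideal J type_ring"
  show "0 \<in> J \<and> (\<forall>x\<in>J. \<forall>y\<in>J. x + y \<in> J) \<and> (\<forall>r. \<forall>x\<in>J. r * x \<in> J)"
    using additive_subgroup.zero_closed[OF ideal.axioms(1)[OF J]]
      additive_subgroup.a_closed[OF ideal.axioms(1)[OF J]] ideal.I_l_closed[OF J] by simp
next
  interpret ring "type_ring :: 'a ring" by (rule ring_type_ring)
  assume J: "0 \<in> J \<and> (\<forall>x\<in>J. \<forall>y\<in>J. x + y \<in> J) \<and> (\<forall>r. \<forall>x\<in>J. r * x \<in> J)"
  have "inv\<^bsub>add_monoid type_ring\<^esub> x \<in> J" if "x \<in> J" for x
  proof -
    have "\<ominus>\<^bsub>type_ring\<^esub> x = - x" by (rule minus_equality) simp_all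
    moreover have "- x \<in> J" using J that by (metis mult_minus1)
    ultimately show ?thesis by (simp add: a_inv_def)
  qed
  moreover have "x * r \<in> J" if "x \<in> J" for x r
    using J that by (metis mult.commute)
  ultimately show "ideal J type_ring"
    using J ring_type_ring by (intro idealI) (auto simp: subgroup_def)
qed

lemma ideal_add_mem: "ideal J type_ring \<Longrightarrow> x \<in> J \<Longrightarrow> y \<in> J \<Longrightarrow> x + y \<in> J"
  and ideal_mult_mem: "ideal J type_ring \<Longrightarrow> x \<in> J \<Longrightarrow> r * x \<in> J"
  by (simp_all add: ideal_type_ring_iff)

lemma primeideal_type_ring_iff:
  fixes J :: "'a::comm_ring_1 set"
  shows "primeideal J type_ring \<longleftrightarrow>
    ideal J type_ring \<and> J \<noteq> UNIV \<and> (\<forall>x y. x * y \<in> J \<longrightarrow> x \<in> J \<or> y \<in> J)"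
  using cring_type_ring by (auto simp: primeideal_def primeideal_axioms_def)

lemma ideal_power_0: "ideal_power J 0 = UNIV"
  by (simp add: nat_pow_def ideals_set_def)

lemma ideal_power_Suc: "ideal_power J (Suc n) = ideal_prod type_ring (ideal_power J n) J"
  by (simp add: nat_pow_def ideals_set_def)

lemma ideal_ideal_power:
  fixes J :: "'a::comm_ring_1 set"
  assumes "ideal J type_ring"
  shows "ideal (ideal_power J n) type_ring"
proof (induction n)
  case 0
  show ?case unfolding ideal_power_0 by (simp add: ideal_type_ring_iff)
next
  case (Suc n)
  then show ?case unfolding ideal_power_Suc
    by (rule ring.ideal_prod_is_ideal[OF ring_type_ring _ assms])
qed

lemma ideal_sum:
  assumes "ideal J type_ring" "\<And>x. x \<in> A \<Longrightarrow> f x \<in> J"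
  shows "sum f A \<in> J"
  using assms by (induction A rule: infinite_finite_induct) (auto simp: ideal_type_ring_iff)

section \<open>Monomial orders and powers of primes generated by variables\<close>

text \<open>The map \<phi> turns a linear order on its target into a monomial order. If
  \<open>a\<close> and \<open>b\<close> are the least exponents of \<open>f\<close> and
  \<open>g\<close>, then \<open>a + b\<close> arises in the product in only one way, so its
  coefficient is the product of two nonzero ones.\<close>

lemma keys_mult_leading:
  fixes \<phi> :: "'a::cancel_comm_monoid_add \<Rightarrow> 'b::{ordered_cancel_comm_monoid_add, linorder}"
    and f g :: "'a \<Rightarrow>\<^sub>0 'k::idom"
  assumes "inj \<phi>" "\<And>x y. \<phi> (x + y) = \<phi> x + \<phi> y" "f \<noteq> 0" "g \<noteq> 0"
  obtains a b
    where "a \<in> Poly_Mapping.keys f" "b \<in> Poly_Mapping.keys g" "a + b \<in> Poly_Mapping.keys (f * g)"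
    "\<And>c. c \<in> Poly_Mapping.keys f \<Longrightarrow> \<phi> a \<le> \<phi> c" "\<And>c. c \<in> Poly_Mapping.keys g \<Longrightarrow> \<phi> b \<le> \<phi> c"
proof -
  have least: "\<exists>a\<in>Poly_Mapping.keys h. \<forall>c\<in>Poly_Mapping.keys h. \<phi> a \<le> \<phi> c" if "h \<noteq> 0"
    for h :: "'a \<Rightarrow>\<^sub>0 'k"
  proof -
    have "Poly_Mapping.keys h \<noteq> {}" using that by simp
    then have "Min (\<phi> ` Poly_Mapping.keys h) \<in> \<phi> ` Poly_Mapping.keys h" by simp
    moreover have "\<forall>c\<in>Poly_Mapping.keys h. Min (\<phi> ` Poly_Mapping.keys h) \<le> \<phi> c" by simp
    ultimately show ?thesis by force
  qed
  obtain a where a: "a \<in> Poly_Mapping.keys f" "\<And>c. c \<in> Poly_Mapping.keys f \<Longrightarrow> \<phi> a \<le> \<phi> c"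
    using least[OF assms(3)] by blast
  obtain b where b: "b \<in> Poly_Mapping.keys g" "\<And>c. c \<in> Poly_Mapping.keys g \<Longrightarrow> \<phi> b \<le> \<phi> c"
    using least[OF assms(4)] by blast
  have unique: "l = a \<and> q = b"
    if "l \<in> Poly_Mapping.keys f" "q \<in> Poly_Mapping.keys g" "a + b = l + q" for l q
  proof -
    have "\<phi> a + \<phi> b = \<phi> l + \<phi> q" using that(3) assms(2) by metis
    then have "\<phi> a = \<phi> l"
      using add_less_le_mono[of "\<phi> a" "\<phi> l" "\<phi> b" "\<phi> q"] a(2)[OF that(1)] b(2)[OF that(2)]
      by (metis less_irrefl order_le_less)
    then have "l = a" using assms(1) by (simp add: inj_eq)
    then show ?thesis using that(3) by simp
  qed
  have "Poly_Mapping.lookup f l * (\<Sum>q. Poly_Mapping.lookup g q when a + b = l + q) =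
      (Poly_Mapping.lookup f a * Poly_Mapping.lookup g b when l = a)" for l
  proof (cases "l \<in> Poly_Mapping.keys f")
    case True
    have "(Poly_Mapping.lookup g q when a + b = l + q) = (Poly_Mapping.lookup g b when l = a when q = b)" for q
      using unique[OF True, of q] by (auto simp: when_def in_keys_iff)
    then show ?thesis by (cases "l = a") (simp_all add: mult_when)
  next
    case False
    then have "l \<noteq> a" using a(1) by blast
    then show ?thesis using False by (simp add: in_keys_iff)
  qed
  then have "Poly_Mapping.lookup (f * g) (a + b) = Poly_Mapping.lookup f a * Poly_Mapping.lookup g b"
    by (simp add: lookup_mult)
  then have "a + b \<in> Poly_Mapping.keys (f * g)" using a(1) b(1) by (simp add: in_keys_iff)
  then show ?thesis using that a b by blast
qed

text \<open>A monomial order refining the degree in the variables of \<open>S\<close>: the lexicographic order of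
  the exponents prefixed by that degree.\<close>

definition graded_exponent :: "'v::finite set \<Rightarrow> ('v \<Rightarrow>\<^sub>0 nat) \<Rightarrow> (nat \<Rightarrow>\<^sub>0 nat)" where
  "graded_exponent S a = Poly_Mapping.single 0 (set_degree S a) +
     (\<Sum>v\<in>UNIV. Poly_Mapping.single (Suc (to_nat v)) (Poly_Mapping.lookup a v))"

lemma graded_exponent_add: "graded_exponent S (a + b) = graded_exponent S a + graded_exponent S b"
  by (simp add: graded_exponent_def lookup_add single_add sum.distrib algebra_simps)

lemma lookup_graded_exponent_0: "Poly_Mapping.lookup (graded_exponent S a) 0 = set_degree S a"
  by (simp add: graded_exponent_def lookup_add lookup_sum lookup_single)

lemma lookup_graded_exponent_Suc: "Poly_Mapping.lookup (graded_exponent S a) (Suc (to_nat v)) = Poly_Mapping.lookup a v"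
  by (simp add: graded_exponent_def lookup_add lookup_sum lookup_single when_def)

lemma inj_graded_exponent: "inj (graded_exponent S)"
  by (rule injI, rule poly_mapping_eqI) (metis lookup_graded_exponent_Suc)

text \<open>The degree sits at position 0, which the lexicographic order compares first.\<close>

lemma set_degree_mono_graded_exponent:
  assumes "graded_exponent S a \<le> graded_exponent S b"
  shows "set_degree S a \<le> set_degree S b"
proof -
  have "Poly_Mapping.lookup f 0 \<le> Poly_Mapping.lookup g 0" if "f \<le> g" for f g :: "nat \<Rightarrow>\<^sub>0 nat"
  proof (cases "f = g")
    case False
    then have "less_fun (Poly_Mapping.lookup f) (Poly_Mapping.lookup g)"
      using that by (simp add: order.order_iff_strict less_poly_mapping.rep_eq)
    then obtain k where "Poly_Mapping.lookup f k < Poly_Mapping.lookup g k"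
        "\<forall>k'<k. Poly_Mapping.lookup f k' = Poly_Mapping.lookup g k'"
      by (auto simp: less_fun_def)
    then show ?thesis by (cases k) auto
  qed simp
  from this[OF assms] show ?thesis by (simp add: lookup_graded_exponent_0)
qed

text \<open>The \<open>i\<close>-th power of the prime ideal generated by the variables in \<open>S\<close>.\<close>

definition degree_ideal :: "'v set \<Rightarrow> nat \<Rightarrow> ('v, 'k::field) mpoly set" where
  "degree_ideal S i = {f. \<forall>a\<in>Poly_Mapping.keys f. i \<le> set_degree S a}"

lemma degree_ideal_mult:
  assumes "f \<in> degree_ideal S i" "g \<in> degree_ideal S j"
  shows "f * g \<in> degree_ideal S (i + j)"
  unfolding degree_ideal_def
proof (intro CollectI ballI)
  fix c assume "c \<in> Poly_Mapping.keys (f * g)"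
  then obtain a b where "c = a + b" "a \<in> Poly_Mapping.keys f" "b \<in> Poly_Mapping.keys g"
    using keys_mult by blast
  then show "i + j \<le> set_degree S c"
    using assms by (auto simp: degree_ideal_def intro: add_mono)
qed

lemma degree_ideal_0: "degree_ideal S 0 = UNIV"
  by (simp add: degree_ideal_def)

lemma ideal_degree_ideal: "ideal (degree_ideal S i) type_ring"
  unfolding ideal_type_ring_iff
proof (intro conjI ballI allI)
  show "0 \<in> degree_ideal S i" by (simp add: degree_ideal_def)
  show "f + g \<in> degree_ideal S i" if "f \<in> degree_ideal S i" "g \<in> degree_ideal S i" for f g
    using that Poly_Mapping.keys_add by (fastforce simp: degree_ideal_def)
  show "r * f \<in> degree_ideal S i" if "f \<in> degree_ideal S i" for r f
    using degree_ideal_mult[of r S 0 f i] that by (simp add: degree_ideal_0)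
qed

text \<open>Powers of the prime of \<open>S\<close> are primary. Some term of \<open>f\<close> has
  degree 0 in \<open>S\<close>, hence so has the least one. The least term of the product then has
  the same degree as the least term of \<open>g\<close>, and the latter is the smallest degree in
  \<open>g\<close>.\<close>

lemma degree_ideal_cancel:
  fixes f g :: "('v::finite, 'k::field) mpoly"
  assumes "f * g \<in> degree_ideal S i" "f \<notin> degree_ideal S 1"
  shows "g \<in> degree_ideal S i"
proof (cases "g = 0")
  case False
  have "f \<noteq> 0" using assms(2) by (auto simp: degree_ideal_def)
  obtain a b
    where ab: "a \<in> Poly_Mapping.keys f" "b \<in> Poly_Mapping.keys g" "a + b \<in> Poly_Mapping.keys (f * g)"
    "\<And>c. c \<in> Poly_Mapping.keys f \<Longrightarrow> graded_exponent S a \<le> graded_exponent S c"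
    "\<And>c. c \<in> Poly_Mapping.keys g \<Longrightarrow> graded_exponent S b \<le> graded_exponent S c"
    by (rule keys_mult_leading[OF inj_graded_exponent[of S] graded_exponent_add \<open>f \<noteq> 0\<close> False]) blast
  obtain c where "c \<in> Poly_Mapping.keys f" "set_degree S c = 0"
    using assms(2) by (auto simp: degree_ideal_def not_le)
  then have "set_degree S a = 0" using set_degree_mono_graded_exponent[OF ab(4)] by fastforce
  moreover have "i \<le> set_degree S (a + b)" using assms(1) ab(3) unfolding degree_ideal_def by blast
  ultimately have "i \<le> set_degree S b" by simp
  then show ?thesis
    using set_degree_mono_graded_exponent[OF ab(5)] by (fastforce simp: degree_ideal_def)
qed (simp add: degree_ideal_def)

lemma primeideal_degree_ideal:
  "primeideal (degree_ideal S 1 :: ('v::finite, 'k::field) mpoly set) type_ring"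
  unfolding primeideal_type_ring_iff
proof (intro conjI allI impI)
  show "ideal (degree_ideal S 1 :: ('v, 'k) mpoly set) type_ring" by (rule ideal_degree_ideal)
  have "(1 :: ('v, 'k) mpoly) \<notin> degree_ideal S 1" by (simp add: degree_ideal_def)
  then show "(degree_ideal S 1 :: ('v, 'k) mpoly set) \<noteq> UNIV" by blast
  show "f \<in> degree_ideal S 1 \<or> g \<in> degree_ideal S 1" if "f * g \<in> degree_ideal S 1"
    for f g :: "('v, 'k) mpoly"
    using degree_ideal_cancel[OF that] by blast
qed

lemma mpoly_var_in_degree_ideal_iff:
  fixes S :: "'v::finite set"
  shows "(mpoly_var v :: ('v, 'k::field) mpoly) \<in> degree_ideal S 1 \<longleftrightarrow> v \<in> S"
  by (simp add: mpoly_var_def degree_ideal_def)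

section \<open>Symbolic powers of edge ideals\<close>

lemma prod_mpoly_var:
  "(\<Prod>v\<in>e. mpoly_var v :: ('v, 'k::field) mpoly) = Poly_Mapping.single (\<Sum>v\<in>e. Poly_Mapping.single v 1) 1"
  by (induction e rule: infinite_finite_induct) (simp_all add: mpoly_var_def mult_single)

lemma ideal_edge_ideal: "ideal (edge_ideal C :: ('v, 'k::field) mpoly set) type_ring"
  unfolding edge_ideal_def by (rule ring.genideal_ideal[OF ring_type_ring]) simp

lemma edge_monomial_in_edge_ideal:
  assumes "e \<in> edges C"
  shows "(\<Prod>v\<in>e. mpoly_var v) \<in> (edge_ideal C :: ('v, 'k::field) mpoly set)"
  using ring.genideal_self[OF ring_type_ring, of "(\<lambda>e. \<Prod>v\<in>e. mpoly_var v :: ('v, 'k) mpoly) ` edges C"] assms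
  unfolding edge_ideal_def by auto

lemma edge_ideal_minimal:
  assumes "ideal J type_ring" "\<And>e. e \<in> edges C \<Longrightarrow> (\<Prod>v\<in>e. mpoly_var v) \<in> J"
  shows "edge_ideal C \<subseteq> (J :: ('v, 'k::field) mpoly set)"
  unfolding edge_ideal_def using assms by (intro ring.genideal_minimal[OF ring_type_ring]) auto

lemma edge_ideal_subset_degree_ideal:
  fixes C :: "'v::finite clutter"
  assumes "vertex_cover C S"
  shows "(edge_ideal C :: ('v, 'k::field) mpoly set) \<subseteq> degree_ideal S 1"
proof (rule edge_ideal_minimal[OF ideal_degree_ideal])
  fix e assume "e \<in> edges C"
  then obtain v where v: "v \<in> e" "v \<in> S" using assms by (auto simp: vertex_cover_def)
  have "(\<Prod>v\<in>e. mpoly_var v :: ('v, 'k) mpoly) = (\<Prod>v\<in>e - {v}. mpoly_var v) * mpoly_var v"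
    using v(1) by (simp add: prod.remove mult.commute)
  also have "\<dots> \<in> degree_ideal S 1"
    by (intro ideal_mult_mem[OF ideal_degree_ideal]) (simp add: mpoly_var_in_degree_ideal_iff v(2) del: One_nat_def)
  finally show "(\<Prod>v\<in>e. mpoly_var v :: ('v, 'k) mpoly) \<in> degree_ideal S 1" .
qed

lemma ideal_power_edge_ideal_subset:
  fixes C :: "'v::finite clutter"
  assumes "vertex_cover C S"
  shows "ideal_power (edge_ideal C :: ('v, 'k::field) mpoly set) i \<subseteq> degree_ideal S i"
proof (induction i)
  case 0
  show ?case by (simp add: degree_ideal_0)
next
  case (Suc i)
  show ?case
  proof
    fix f :: "('v, 'k) mpoly" assume "f \<in> ideal_power (edge_ideal C) (Suc i)"
    then have "f \<in> ideal_prod type_ring (ideal_power (edge_ideal C) i) (edge_ideal C)"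
      by (simp only: ideal_power_Suc)
    then show "f \<in> degree_ideal S (Suc i)"
    proof induction
      case (prod f g)
      then have "f \<in> degree_ideal S i" "g \<in> degree_ideal S 1"
        using Suc edge_ideal_subset_degree_ideal[OF assms] by blast+
      then show ?case using degree_ideal_mult[of f S i g 1] by simp
    next
      case (sum f g)
      then show ?case by (simp add: ideal_add_mem[OF ideal_degree_ideal])
    qed
  qed
qed

section \<open>The minimal primes of the edge ideal\<close>

lemma vertex_cover_contains_minimal:
  assumes "finite S" "vertex_cover C S"
  obtains T where "T \<subseteq> S" "minimal_vertex_cover C T"
proof -
  have "\<exists>T\<subseteq>S. minimal_vertex_cover C T"
    using assms
  proof (induction S rule: finite_psubset_induct)
    case (psubset S)
    show ?case
    proof (cases "minimal_vertex_cover C S")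
      case False
      then obtain T where "T \<subset> S" "vertex_cover C T"
        using psubset.prems by (auto simp: minimal_vertex_cover_def)
      then obtain T' where "T' \<subseteq> T" "minimal_vertex_cover C T'" using psubset.IH by metis
      then show ?thesis using \<open>T \<subset> S\<close> by (intro exI[of _ T']) simp
    qed blast
  qed
  then show ?thesis using that by blast
qed

text \<open>A term of positive degree in \<open>S\<close> is a multiple of some variable from
  \<open>S\<close>.\<close>

lemma degree_ideal_subset_ideal:
  assumes "ideal Q type_ring" "\<And>v. v \<in> S \<Longrightarrow> (mpoly_var v :: ('v::finite, 'k::field) mpoly) \<in> Q"
  shows "degree_ideal S 1 \<subseteq> Q"
proof
  fix f :: "('v, 'k) mpoly" assume f: "f \<in> degree_ideal S 1"
  have "Poly_Mapping.single a (Poly_Mapping.lookup f a) \<in> Q" if "a \<in> Poly_Mapping.keys f" for a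
  proof -
    have "set_degree S a \<noteq> 0" using f that by (fastforce simp: degree_ideal_def)
    then obtain v where v: "v \<in> S" "Poly_Mapping.lookup a v \<noteq> 0"
      unfolding set_degree_def by (meson sum.not_neutral_contains_not_neutral)
    have "a = (a - Poly_Mapping.single v 1) + Poly_Mapping.single v 1"
      using v(2)
        by (intro poly_mapping_eqI) (auto simp: lookup_add lookup_minus lookup_single when_def)
    then have "Poly_Mapping.single a (Poly_Mapping.lookup f a) =
        Poly_Mapping.single (a - Poly_Mapping.single v 1) (Poly_Mapping.lookup f a) * mpoly_var v"
      by (simp add: mpoly_var_def mult_single)
    then show ?thesis using ideal_mult_mem[OF assms(1) assms(2)[OF v(1)]] by simp
  qed
  then have "(\<Sum>a\<in>Poly_Mapping.keys f. Poly_Mapping.single a (Poly_Mapping.lookup f a)) \<in> Q"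
    by (rule ideal_sum[OF assms(1)])
  then show "f \<in> Q" by (simp add: poly_mapping_sum_single)
qed

lemma prod_in_primeideal:
  assumes "primeideal Q type_ring" "finite A" "(\<Prod>x\<in>A. f x) \<in> Q"
  shows "\<exists>x\<in>A. f x \<in> Q"
  using assms(2,3)
proof (induction A)
  case empty
  \<comment> \<open>An empty product would put 1 into the proper ideal \<open>Q\<close>.\<close>
  then have "r * 1 \<in> Q" for r
    using assms(1) unfolding primeideal_type_ring_iff ideal_type_ring_iff by (metis prod.empty)
  then have "Q = UNIV" by auto
  then show ?case using assms(1) by (simp add: primeideal_type_ring_iff)
next
  case (insert x A)
  then show ?case using assms(1) by (auto simp: primeideal_type_ring_iff)
qed

text \<open>The variables in \<open>Q\<close> form a vertex cover, because a prime ideal that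
  contains an edge monomial contains one of its variables.\<close>

lemma primeideal_contains_degree_ideal:
  fixes C :: "'v::finite clutter" and Q :: "('v, 'k::field) mpoly set"
  assumes "verts C = UNIV" "primeideal Q type_ring" "edge_ideal C \<subseteq> Q"
  obtains S where "minimal_vertex_cover C S" "degree_ideal S 1 \<subseteq> Q"
proof -
  have "vertex_cover C {v. (mpoly_var v :: ('v, 'k) mpoly) \<in> Q}"
    unfolding vertex_cover_def assms(1)
  proof (intro conjI ballI)
    fix e assume "e \<in> edges C"
    then have "(\<Prod>v\<in>e. mpoly_var v :: ('v, 'k) mpoly) \<in> Q"
      using edge_monomial_in_edge_ideal assms(3) by blast
    then show "e \<inter> {v. (mpoly_var v :: ('v, 'k) mpoly) \<in> Q} \<noteq> {}"
      using prod_in_primeideal[OF assms(2)]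
        by (metis (no_types, lifting) IntI finite_code mem_Collect_eq empty_iff)
  qed simp
  then obtain S where "S \<subseteq> {v. (mpoly_var v :: ('v, 'k) mpoly) \<in> Q}" "minimal_vertex_cover C S"
    by (rule vertex_cover_contains_minimal[OF finite])
  moreover from this have "degree_ideal S 1 \<subseteq> Q"
    using assms(2) by (intro degree_ideal_subset_ideal) (auto simp: primeideal_type_ring_iff)
  ultimately show ?thesis using that by blast
qed

text \<open>Every prime above the edge ideal contains the prime of some minimal cover. Inclusion of
  such primes is inclusion of the covers, and minimal covers are pairwise incomparable.\<close>

lemma minimal_primes_edge_ideal:
  fixes C :: "'v::finite clutter"
  assumes "verts C = UNIV"
  shows "minimal_primes (edge_ideal C :: ('v, 'k::field) mpoly set) = {degree_ideal S 1 | S. minimal_vertex_cover C S}"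
proof (intro equalityI subsetI)
  fix P :: "('v, 'k) mpoly set" assume P: "P \<in> minimal_primes (edge_ideal C)"
  then have "primeideal P type_ring" "edge_ideal C \<subseteq> P" by (auto simp: minimal_primes_def)
  then obtain S where S: "minimal_vertex_cover C S" "degree_ideal S 1 \<subseteq> P"
    by (rule primeideal_contains_degree_ideal[OF assms])
  have "edge_ideal C \<subseteq> degree_ideal S 1"
    using S(1) by (intro edge_ideal_subset_degree_ideal) (simp add: minimal_vertex_cover_def)
  then have "degree_ideal S 1 = P"
    using P S(2) primeideal_degree_ideal unfolding minimal_primes_def by blast
  then show "P \<in> {degree_ideal S 1 | S. minimal_vertex_cover C S}" using S(1) by blast
next
  fix P :: "('v, 'k) mpoly set" assume "P \<in> {degree_ideal S 1 | S. minimal_vertex_cover C S}"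
  then obtain S where S: "minimal_vertex_cover C S" "P = degree_ideal S 1" by blast
  have "Q = P" if Q: "primeideal Q type_ring" "edge_ideal C \<subseteq> Q" "Q \<subseteq> P" for Q
  proof -
    obtain T where T: "minimal_vertex_cover C T" "degree_ideal T 1 \<subseteq> Q"
      by (rule primeideal_contains_degree_ideal[OF assms Q(1,2)])
    have "v \<in> S" if "v \<in> T" for v
      using that T(2) Q(3) S(2) mpoly_var_in_degree_ideal_iff by blast
    then have "T = S" using T(1) S(1) unfolding minimal_vertex_cover_def by blast
    then show ?thesis using T(2) Q(3) S(2) by blast
  qed
  moreover have "edge_ideal C \<subseteq> P"
    unfolding S(2) using S(1)
      by (intro edge_ideal_subset_degree_ideal) (simp add: minimal_vertex_cover_def)
  ultimately show "P \<in> minimal_primes (edge_ideal C)"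
    using primeideal_degree_ideal S(2) by (simp add: minimal_primes_def)
qed

text \<open>By minimality of \<open>T\<close>, every \<open>v \<in> T\<close> lies on an edge that meets \<open>T\<close> only in \<open>v\<close>; the
  other vertices of that edge are supplied by the factor \<open>\<Prod>w\<notin>T. x\<^sub>w\<close>.\<close>

lemma single_in_ideal_power:
  fixes C :: "'v::finite clutter" and c :: "'k::field"
  assumes T: "minimal_vertex_cover C T" and "i \<le> set_degree T a"
  shows "Poly_Mapping.single (a + (\<Sum>w\<in>-T. Poly_Mapping.single w i)) c \<in> ideal_power (edge_ideal C) i"
  using assms(2)
proof (induction i arbitrary: a)
  case 0
  show ?case unfolding ideal_power_0 by simp
next
  case (Suc i)
  then have "set_degree T a \<noteq> 0" by simp
  then obtain v where v: "v \<in> T" "Poly_Mapping.lookup a v \<noteq> 0"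
    unfolding set_degree_def by (meson sum.not_neutral_contains_not_neutral)
  have "\<not> vertex_cover C (T - {v})" "vertex_cover C T"
    using T v(1) unfolding minimal_vertex_cover_def by blast+
  then obtain e where e: "e \<in> edges C" "e \<inter> T = {v}" unfolding vertex_cover_def by blast
  \<comment> \<open>One of the \<open>Suc i\<close> copies of the variables outside \<open>T\<close>
    is spent: those on \<open>e\<close> complete \<open>v\<close> to the edge monomial, the others
    go into \<open>a'\<close>. The degree in \<open>T\<close> drops by just one.\<close>
  define a' where "a' = a - Poly_Mapping.single v 1 + (\<Sum>w\<in>- T - e. Poly_Mapping.single w 1)"
  have a: "a = a - Poly_Mapping.single v 1 + Poly_Mapping.single v 1"
    using v(2)
      by (intro poly_mapping_eqI) (auto simp: lookup_add lookup_minus lookup_single when_def)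
  have "set_degree T a = set_degree T (a - Poly_Mapping.single v 1) + 1"
    by (subst a) (simp add: v(1))
  then have "i \<le> set_degree T a'" using Suc.prems by (simp add: a'_def)
  have "a + (\<Sum>w\<in>-T. Poly_Mapping.single w (Suc i)) = (a' + (\<Sum>w\<in>-T. Poly_Mapping.single w i)) + (\<Sum>v\<in>e. Poly_Mapping.single v 1)"
  proof -
    have split: "(\<Sum>w\<in>-T. Poly_Mapping.single w (1::nat)) = (\<Sum>w\<in>-T - e. Poly_Mapping.single w 1) + (\<Sum>w\<in>e - {v}. Poly_Mapping.single w 1)"
      using e(2) by (subst sum.union_disjoint[symmetric]) (auto intro!: sum.cong)
    have "(\<Sum>w\<in>e. Poly_Mapping.single w (1::nat)) = Poly_Mapping.single v 1 + (\<Sum>w\<in>e - {v}. Poly_Mapping.single w 1)"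
      using e(2) by (intro sum.remove) auto
    moreover have "(\<Sum>w\<in>-T. Poly_Mapping.single w (Suc i)) = (\<Sum>w\<in>-T. Poly_Mapping.single w i) + (\<Sum>w\<in>-T. Poly_Mapping.single w 1)"
      by (simp flip: sum.distrib single_add)
    ultimately show ?thesis
      by (subst a) (simp add: a'_def split ac_simps del: One_nat_def)
  qed
  then have "Poly_Mapping.single (a + (\<Sum>w\<in>-T. Poly_Mapping.single w (Suc i))) c =
      Poly_Mapping.single (a' + (\<Sum>w\<in>-T. Poly_Mapping.single w i)) c \<otimes>\<^bsub>type_ring\<^esub> (\<Prod>v\<in>e. mpoly_var v)"
    by (simp only: prod_mpoly_var type_ring_simps mult_single mult_1_right)
  also have "\<dots> \<in> ideal_power (edge_ideal C) (Suc i)"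
    unfolding ideal_power_Suc
    by (intro ideal_prod.prod Suc.IH \<open>i \<le> set_degree T a'\<close> edge_monomial_in_edge_ideal e(1))
  finally show ?case .
qed

text \<open>Denominators avoid the minimal primes, so they can be cancelled modulo each
  \<open>degree_ideal S i\<close>. Conversely, one denominator \<open>s\<close> works for all
  \<open>f\<close> at once.\<close>

lemma symbolic_power_edge_ideal:
  fixes C :: "'v::finite clutter"
  assumes "verts C = UNIV" "i \<ge> 1"
  shows "symbolic_power (edge_ideal C :: ('v, 'k::field) mpoly set) i =
    {f. \<forall>a\<in>Poly_Mapping.keys f. (a, i) \<in> simis_monoid C}"
proof -
  let ?I = "edge_ideal C :: ('v, 'k) mpoly set"
  define U where "U = {s :: ('v, 'k) mpoly. \<forall>S. minimal_vertex_cover C S \<longrightarrow> s \<notin> degree_ideal S 1}"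
  have U: "- \<Union>{degree_ideal S 1 | S. minimal_vertex_cover C S} = U"
    unfolding U_def by auto
  have sym: "symbolic_power ?I i = {f. \<exists>g\<in>ideal_power ?I i. \<exists>s\<in>U. \<exists>u\<in>U. u * (s * f - g) = 0}"
    unfolding symbolic_power_def Let_def minimal_primes_edge_ideal[OF assms(1)] U ..
  define y :: "'v set \<Rightarrow> 'v \<Rightarrow>\<^sub>0 nat" where "y T = (\<Sum>w\<in>-T. Poly_Mapping.single w i)" for T
  \<comment> \<open>The monomial with exponent \<open>y T\<close> avoids the prime of
    \<open>T\<close> but lies in those of the other minimal covers, hence the sum. As
    \<open>i \<ge> 1\<close>, distinct covers have distinct exponents, so no terms cancel.\<close>
  define s :: "('v, 'k) mpoly"
    where "s = (\<Sum>T | minimal_vertex_cover C T. Poly_Mapping.single (y T) 1)"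
  have lookup_y: "Poly_Mapping.lookup (y T) w = (if w \<in> T then 0 else i)" for T w
    by (simp add: y_def lookup_sum lookup_single when_def)
  have inj_y: "T = T'" if "y T = y T'" for T T'
  proof (rule Set.set_eqI)
    fix w
    show "w \<in> T \<longleftrightarrow> w \<in> T'"
      using lookup_y[of T w] lookup_y[of T' w] that assms(2) by (auto split: if_splits)
  qed
  have "s \<in> U"
    unfolding U_def
  proof (intro CollectI allI impI)
    fix S assume S: "minimal_vertex_cover C S"
    have "Poly_Mapping.lookup s (y S) = (\<Sum>T | minimal_vertex_cover C T. if T = S then 1 else 0)"
      unfolding s_def lookup_sum by (rule sum.cong) (auto simp: lookup_single when_def dest: inj_y)
    then have "y S \<in> Poly_Mapping.keys s" using S by (simp add: in_keys_iff)
    moreover have "set_degree S (y S) = 0" by (simp add: set_degree_def lookup_y)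
    ultimately show "s \<notin> degree_ideal S 1" by (force simp: degree_ideal_def)
  qed
  show ?thesis
  proof (intro equalityI subsetI)
    fix f assume "f \<in> symbolic_power ?I i"
    then obtain g t u where g: "g \<in> ideal_power ?I i" "t \<in> U" "u \<in> U" "u * (t * f - g) = 0"
      unfolding sym by blast
    have "f \<in> degree_ideal S i" if S: "minimal_vertex_cover C S" for S
    proof -
      have "g \<in> degree_ideal S i"
        using g(1) S ideal_power_edge_ideal_subset unfolding minimal_vertex_cover_def by blast
      moreover have "u * (t * f) = u * g" using g(4) by (simp add: right_diff_distrib)
      ultimately have "u * (t * f) \<in> degree_ideal S i"
        by (simp add: ideal_mult_mem[OF ideal_degree_ideal])
      moreover have "u \<notin> degree_ideal S 1" "t \<notin> degree_ideal S 1" using g(2,3) S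
        by (auto simp: U_def)
      ultimately show ?thesis using degree_ideal_cancel by blast
    qed
    then show "f \<in> {f. \<forall>a\<in>Poly_Mapping.keys f. (a, i) \<in> simis_monoid C}"
      by (auto simp: degree_ideal_def simis_monoid_def)
  next
    fix f :: "('v, 'k) mpoly" assume f: "f \<in> {f. \<forall>a\<in>Poly_Mapping.keys f. (a, i) \<in> simis_monoid C}"
    have "s * f = (\<Sum>T | minimal_vertex_cover C T. \<Sum>a\<in>Poly_Mapping.keys f.
        Poly_Mapping.single (a + y T) (Poly_Mapping.lookup f a))"
      by (subst poly_mapping_sum_single[of f, symmetric])
        (simp add: s_def sum_product mult_single add.commute del: poly_mapping_sum_single)
    also have "\<dots> \<in> ideal_power ?I i"
      unfolding y_def using f
      by (intro ideal_sum ideal_ideal_power ideal_edge_ideal single_in_ideal_power) (auto simp: simis_monoid_def)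
    finally have "s * f \<in> ideal_power ?I i" .
    \<comment> \<open>The numerator is \<open>s * f\<close>, and \<open>s\<close> plays the role of
      both elements of \<open>U\<close>.\<close>
    moreover have "s * (s * f - s * f) = 0" by simp
    ultimately show "f \<in> symbolic_power ?I i"
      unfolding sym using \<open>s \<in> U\<close> by blast
  qed
qed

text \<open>The definition leaves the coefficient of degree 0 in \<open>t\<close> unrestricted; so
  does the monoid, which contains all \<open>(a, 0)\<close>.\<close>

lemma symbolic_Rees_algebra_edge_ideal:
  fixes C :: "'v::finite clutter"
  assumes "verts C = UNIV"
  shows "symbolic_Rees_algebra (edge_ideal C :: ('v, 'k::field) mpoly set) =
    K_vs.span (exponent_monomial ` simis_monoid C)"
proof -
  have "(\<forall>i\<ge>1. P i) \<longleftrightarrow> (\<forall>i. P i)" if "P 0" for P :: "nat \<Rightarrow> bool"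
    using that by (metis One_nat_def Suc_leI gr0I)
  moreover have "(a, 0) \<in> simis_monoid C" for a by (simp add: simis_monoid_def)
  ultimately show ?thesis
    by (simp add: symbolic_Rees_algebra_def span_exponent_monomials symbolic_power_edge_ideal[OF assms])
qed

section \<open>Covering numbers of parallelizations\<close>

lemma alpha0_le_card: "vertex_cover C T \<Longrightarrow> alpha0 C \<le> card T"
  unfolding alpha0_def by (rule Least_le) blast

lemma alpha0_attained:
  assumes "vertex_cover C T"
  obtains S where "vertex_cover C S" "card S = alpha0 C"
  using LeastI_ex[of "\<lambda>k. \<exists>S. vertex_cover C S \<and> card S = k"] assms
  unfolding alpha0_def by blast

text \<open>For a set \<open>W\<close> of vertices of a parallelization, this is the exponent whose
  parallelization agrees, up to renumbering copies, with the subclutter induced on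
  \<open>W\<close>.\<close>

definition copies :: "('v::finite \<times> nat) set \<Rightarrow> ('v \<Rightarrow>\<^sub>0 nat)" where
  "copies W = Abs_poly_mapping (\<lambda>v. card {j. (v, j) \<in> W})"

lemma lookup_copies: "Poly_Mapping.lookup (copies W) v = card {j. (v, j) \<in> W}"
  by (simp add: copies_def)

lemma card_Collect_fst:
  fixes W :: "('v::finite \<times> nat) set"
  assumes "finite W"
  shows "card {x \<in> W. fst x \<in> S} = set_degree S (copies W)"
proof -
  have fin: "finite {j. (v, j) \<in> W}" for v
    by (rule finite_subset[of _ "snd ` W"]) (use assms in force)+
  have "{x \<in> W. fst x \<in> S} = (SIGMA v:S. {j. (v, j) \<in> W})" by auto
  then show ?thesis using fin by (simp add: set_degree_def lookup_copies)
qed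

lemma finite_verts_parallelization:
  fixes C :: "'v::finite clutter"
  shows "finite (verts (parallelization C a))"
proof -
  have "verts (parallelization C a) \<subseteq> (SIGMA v:UNIV. {..Poly_Mapping.lookup a v})"
    by (auto simp: parallelization_def)
  then show ?thesis by (rule finite_subset) simp
qed

lemma edges_parallelization_subset:
  "is_clutter C \<Longrightarrow> e \<in> edges (parallelization C a) \<Longrightarrow> e \<subseteq> verts (parallelization C a)"
  unfolding parallelization_def is_clutter_def by auto

lemma edges_parallelization_nonempty:
  "is_clutter C \<Longrightarrow> e \<in> edges (parallelization C a) \<Longrightarrow> e \<noteq> {}"
  unfolding parallelization_def is_clutter_def by auto

text \<open>A vertex of \<open>C\<close> is in the cover of \<open>C\<close> induced by a cover \<open>T\<close> of the parallelization when
  all its copies are in \<open>T\<close>; conversely all copies of the vertices of a cover of \<open>C\<close> form a cover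
  of the parallelization.\<close>

lemma le_alpha0_induced_parallelization_iff:
  fixes C :: "'v::finite clutter"
  assumes C: "is_clutter C" "verts C = UNIV" and W: "W \<subseteq> verts (parallelization C a)"
  shows "k \<le> alpha0 (induced_subclutter (parallelization C a) W) \<longleftrightarrow> (copies W, k) \<in> simis_monoid C"
proof -
  let ?P = "parallelization C a"
  let ?D = "induced_subclutter ?P W"
  have "finite W" using W finite_verts_parallelization finite_subset by blast
  show ?thesis
  proof
    assume k: "k \<le> alpha0 ?D"
    have "k \<le> set_degree S (copies W)" if S: "minimal_vertex_cover C S" for S
    proof -
      have "vertex_cover ?D {x \<in> W. fst x \<in> S}"
        unfolding vertex_cover_def
      proof (intro conjI ballI)
        show "{x \<in> W. fst x \<in> S} \<subseteq> verts ?D" by (auto simp: induced_subclutter_def)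
        fix f assume "f \<in> edges ?D"
        then obtain e j where f: "f = (\<lambda>v. (v, j v)) ` e" "e \<in> edges C" "f \<subseteq> W"
          by (auto simp: induced_subclutter_def parallelization_def)
        obtain v where "v \<in> e" "v \<in> S"
          using S f(2) unfolding minimal_vertex_cover_def vertex_cover_def by blast
        then have "(v, j v) \<in> f \<inter> {x \<in> W. fst x \<in> S}" using f(1,3) by auto
        then show "f \<inter> {x \<in> W. fst x \<in> S} \<noteq> {}" by blast
      qed
      then have "alpha0 ?D \<le> card {x \<in> W. fst x \<in> S}" by (rule alpha0_le_card)
      then show ?thesis using k card_Collect_fst[OF \<open>finite W\<close>] by simp
    qed
    then show "(copies W, k) \<in> simis_monoid C" by (simp add: simis_monoid_def)
  next
    assume k: "(copies W, k) \<in> simis_monoid C"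
    have "f \<inter> W \<noteq> {}" if "f \<in> edges ?D" for f
      using that edges_parallelization_nonempty[OF C(1), of f a]
        by (auto simp: induced_subclutter_def)
    then have "vertex_cover ?D W" by (auto simp: vertex_cover_def induced_subclutter_def)
    then obtain T where T: "vertex_cover ?D T" "card T = alpha0 ?D" by (rule alpha0_attained)
    then have "T \<subseteq> W" by (auto simp: vertex_cover_def induced_subclutter_def)
    \<comment> \<open>A vertex without copies in \<open>W\<close> belongs to \<open>S\<close>
      vacuously.\<close>
    define S where "S = {v. \<forall>j. (v, j) \<in> W \<longrightarrow> (v, j) \<in> T}"
    have "vertex_cover C S"
      unfolding vertex_cover_def
    proof (intro conjI ballI)
      show "S \<subseteq> verts C" using C(2) by simp
      fix e assume e: "e \<in> edges C"
      show "e \<inter> S \<noteq> {}"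
      proof
        assume "e \<inter> S = {}"
        then have "\<forall>v\<in>e. \<exists>j. (v, j) \<in> W \<and> (v, j) \<notin> T" by (auto simp: S_def)
        \<comment> \<open>The chosen copies form an edge inside \<open>W\<close> that
          \<open>T\<close> misses.\<close>
        then obtain j where j: "\<forall>v\<in>e. (v, j v) \<in> W \<and> (v, j v) \<notin> T" by metis
        then have "\<forall>v\<in>e. 1 \<le> j v \<and> j v \<le> Poly_Mapping.lookup a v"
          using W by (auto simp: parallelization_def)
        then have "(\<lambda>v. (v, j v)) ` e \<in> edges ?P" using e by (auto simp: parallelization_def)
        then have "(\<lambda>v. (v, j v)) ` e \<in> edges ?D" using j by (auto simp: induced_subclutter_def)
        then have "(\<lambda>v. (v, j v)) ` e \<inter> T \<noteq> {}" using T(1) by (simp add: vertex_cover_def)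
        then show False using j by auto
      qed
    qed
    then obtain S' where S': "S' \<subseteq> S" "minimal_vertex_cover C S'"
      by (rule vertex_cover_contains_minimal[OF finite])
    have "k \<le> card {x \<in> W. fst x \<in> S'}"
      using k S'(2) card_Collect_fst[OF \<open>finite W\<close>] by (simp add: simis_monoid_def)
    also have "\<dots> \<le> card T"
    proof (rule card_mono)
      show "finite T" using \<open>T \<subseteq> W\<close> \<open>finite W\<close> finite_subset by blast
      show "{x \<in> W. fst x \<in> S'} \<subseteq> T" using S'(1) by (auto simp: S_def)
    qed
    finally show "k \<le> alpha0 ?D" using T(2) by simp
  qed
qed

lemma copies_verts_parallelization:
  fixes C :: "'v::finite clutter"
  assumes "verts C = UNIV"
  shows "copies (verts (parallelization C a)) = a"
proof (rule poly_mapping_eqI)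
  fix v
  have "{j. (v, j) \<in> verts (parallelization C a)} = {1..Poly_Mapping.lookup a v}"
    using assms by (auto simp: parallelization_def)
  then show "Poly_Mapping.lookup (copies (verts (parallelization C a))) v = Poly_Mapping.lookup a v"
    by (simp add: lookup_copies)
qed

lemma induced_verts_parallelization:
  "is_clutter C \<Longrightarrow> induced_subclutter (parallelization C a) (verts (parallelization C a)) = parallelization C a"
  by (rule clutter.equality) (use edges_parallelization_subset[of C] in \<open>auto simp: induced_subclutter_def\<close>)

lemma le_alpha0_parallelization_iff:
  fixes C :: "'v::finite clutter"
  assumes "is_clutter C" "verts C = UNIV"
  shows "k \<le> alpha0 (parallelization C a) \<longleftrightarrow> (a, k) \<in> simis_monoid C"
  using le_alpha0_induced_parallelization_iff[OF assms subset_refl, of k a]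
  by (simp add: induced_verts_parallelization copies_verts_parallelization assms)

section \<open>Decompositions of parallelizations and of exponents\<close>

lemma copies_Un:
  fixes W Y :: "('v::finite \<times> nat) set"
  assumes "finite W" "finite Y" "W \<inter> Y = {}"
  shows "copies (W \<union> Y) = copies W + copies Y"
proof (rule poly_mapping_eqI)
  fix v
  have fin: "finite {j. (v, j) \<in> Z}" if "finite Z" for Z :: "('v \<times> nat) set"
    by (rule finite_subset[of _ "snd ` Z"]) (use that in force)+
  have "{j. (v, j) \<in> W \<union> Y} = {j. (v, j) \<in> W} \<union> {j. (v, j) \<in> Y}" by blast
  then show "Poly_Mapping.lookup (copies (W \<union> Y)) v = Poly_Mapping.lookup (copies W + copies Y) v"
    using assms by (simp add: lookup_copies lookup_add) (subst card_Un_disjoint, auto intro: fin)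
qed

lemma copies_eq_0_iff:
  fixes W :: "('v::finite \<times> nat) set"
  assumes "finite W"
  shows "copies W = 0 \<longleftrightarrow> W = {}"
proof
  assume "copies W = 0"
  then have "card {x \<in> W. fst x \<in> UNIV} = 0"
    unfolding card_Collect_fst[OF assms] by simp
  then show "W = {}" using assms by simp
qed (simp add: poly_mapping_eq_iff lookup_copies fun_eq_iff)

text \<open>Counting copies turns a partition of the vertices into a splitting of \<open>a\<close>.
  The covering number of an induced subclutter depends only on these counts.\<close>

lemma decomposable_parallelization_iff:
  fixes C :: "'v::finite clutter"
  assumes C: "is_clutter C" "verts C = UNIV"
  shows "decomposable (parallelization C a) \<longleftrightarrow>
    (\<exists>a1 a2. a1 \<noteq> 0 \<and> a2 \<noteq> 0 \<and> a = a1 + a2 \<and>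
      alpha0 (parallelization C a) = alpha0 (parallelization C a1) + alpha0 (parallelization C a2))"
proof -
  let ?V = "verts (parallelization C a)"
  \<comment> \<open>Both numbers have the same lower bounds \<open>k\<close>, described by the
    monoid.\<close>
  have \<alpha>: "alpha0 (induced_subclutter (parallelization C a) W) = alpha0 (parallelization C (copies W))"
    if "W \<subseteq> ?V" for W
    using le_alpha0_induced_parallelization_iff[OF C that] le_alpha0_parallelization_iff[OF C]
    by (metis le_antisym order_refl)
  have fin: "finite W" if "W \<subseteq> ?V" for W
    using that finite_verts_parallelization finite_subset by blast
  show ?thesis
  proof
    assume "decomposable (parallelization C a)"
    then obtain X1 X2 where W: "X1 \<noteq> {}" "X2 \<noteq> {}" "X1 \<inter> X2 = {}" "?V = X1 \<union> X2"
        "alpha0 (parallelization C a) = alpha0 (induced_subclutter (parallelization C a) X1)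
          + alpha0 (induced_subclutter (parallelization C a) X2)"
      unfolding decomposable_def by blast
    then have sub: "X1 \<subseteq> ?V" "X2 \<subseteq> ?V" by auto
    have "a = copies X1 + copies X2"
      using copies_Un[OF fin[OF sub(1)] fin[OF sub(2)] W(3)] copies_verts_parallelization[OF C(2), of a] W(4) by simp
    moreover have "copies X1 \<noteq> 0" "copies X2 \<noteq> 0"
      using W(1,2) by (simp_all add: copies_eq_0_iff[OF fin] sub)
    moreover have "alpha0 (parallelization C a) =
        alpha0 (parallelization C (copies X1)) + alpha0 (parallelization C (copies X2))"
      using W(5) \<alpha>[OF sub(1)] \<alpha>[OF sub(2)] by simp
    ultimately show "\<exists>a1 a2. a1 \<noteq> 0 \<and> a2 \<noteq> 0 \<and> a = a1 + a2 \<and>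
      alpha0 (parallelization C a) = alpha0 (parallelization C a1) + alpha0 (parallelization C a2)"
      by blast
  next
    assume "\<exists>a1 a2. a1 \<noteq> 0 \<and> a2 \<noteq> 0 \<and> a = a1 + a2 \<and>
      alpha0 (parallelization C a) = alpha0 (parallelization C a1) + alpha0 (parallelization C a2)"
    then obtain a1 a2 where a: "a1 \<noteq> 0" "a2 \<noteq> 0" "a = a1 + a2"
      "alpha0 (parallelization C a) = alpha0 (parallelization C a1) + alpha0 (parallelization C a2)"
        by blast
    define X1 where "X1 = verts (parallelization C a1)"
    \<comment> \<open>\<open>X1\<close> takes the first copies of each vertex. The remaining ones
      are numbered differently from the vertices of the parallelization by \<open>a2\<close>, but
      their counts are given by \<open>a2\<close>.\<close>
    define X2 where "X2 = ?V - X1"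
    have sub: "X1 \<subseteq> ?V" "X2 \<subseteq> ?V"
      using a(3) by (auto simp: X1_def X2_def parallelization_def lookup_add)
    have copies1: "copies X1 = a1" unfolding X1_def by (rule copies_verts_parallelization[OF C(2)])
    have "copies X1 + copies X2 = a"
      using copies_Un[OF fin[OF sub(1)] fin[OF sub(2)]] sub copies_verts_parallelization[OF C(2), of a]
      by (simp add: X2_def Un_absorb1)
    then have copies2: "copies X2 = a2" using copies1 a(3) by simp
    have "X1 \<noteq> {}" "X2 \<noteq> {}"
      using a(1,2) copies1 copies2 copies_eq_0_iff fin[OF sub(1)] fin[OF sub(2)] by metis+
    moreover have "X1 \<inter> X2 = {}" "?V = X1 \<union> X2" using sub by (auto simp: X2_def)
    ultimately show "decomposable (parallelization C a)"
      unfolding decomposable_def using a(4) \<alpha>[OF sub(1)] \<alpha>[OF sub(2)] copies1 copies2 by metis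
  qed
qed

text \<open>If \<open>b\<close> is not maximal above \<open>a\<close>, a variable can be split off
  from \<open>(a, b)\<close>; if it is maximal, splittings are decompositions of the
  parallelization. For a one-vertex edge \<open>{v}\<close> the irreducible
  \<open>(single v 1, 0)\<close> would be missed, since its covering number is 1; edges of size at
  least 2 exclude this.\<close>

lemma irreducibles_simis_monoid:
  fixes C :: "'v::finite clutter"
  assumes C: "is_clutter C" "verts C = UNIV" and card: "\<forall>e\<in>edges C. card e \<ge> 2"
  shows "irreducibles (simis_monoid C) =
    {(a, alpha0 (parallelization C a)) | a. a \<noteq> 0 \<and> \<not> decomposable (parallelization C a)}"
proof -
  note mem = le_alpha0_parallelization_iff[OF C, symmetric]
  have cover: "vertex_cover C (- {v})" for v
    unfolding vertex_cover_def C(2)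
  proof (intro conjI ballI)
    fix e assume "e \<in> edges C"
    then have "\<not> card e \<le> card {v}" using card by fastforce
    then have "\<not> e \<subseteq> {v}" using card_mono[of "{v}" e] by blast
    then show "e \<inter> - {v} \<noteq> {}" by blast
  qed simp
  have \<alpha>_single: "alpha0 (parallelization C (Poly_Mapping.single v 1)) = 0" for v
  proof -
    obtain S where "S \<subseteq> - {v}" "minimal_vertex_cover C S"
      by (rule vertex_cover_contains_minimal[OF finite cover])
    then have "(Poly_Mapping.single v 1, 1) \<notin> simis_monoid C" by (auto simp: simis_monoid_def)
    then show ?thesis by (simp add: mem)
  qed
  have \<alpha>_add: "alpha0 (parallelization C a) + alpha0 (parallelization C b) \<le> alpha0 (parallelization C (a + b))" for a b
    using simis_monoid_add[of "(a, alpha0 (parallelization C a))" C "(b, alpha0 (parallelization C b))"]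
    by (simp add: mem)
  have \<alpha>_0: "alpha0 (parallelization C 0) = 0"
    using \<alpha>_add[of 0 0] by simp
  show ?thesis
  proof (intro equalityI subsetI)
    fix x assume x: "x \<in> irreducibles (simis_monoid C)"
    obtain a b where ab: "x = (a, b)" by (cases x)
    have irr: "y = 0 \<or> z = 0" if "y \<in> simis_monoid C" "z \<in> simis_monoid C" "(a, b) = y + z" for y z
      using x ab that by (auto simp: irreducibles_def)
    have b: "b \<le> alpha0 (parallelization C a)" using x ab by (auto simp: irreducibles_def mem)
    have "a \<noteq> 0" using x ab b \<alpha>_0 by (auto simp: irreducibles_def zero_prod_def)
    have "b = alpha0 (parallelization C a)"
    proof (rule ccontr)
      assume "b \<noteq> alpha0 (parallelization C a)"
      then have "Suc b \<le> alpha0 (parallelization C a)" using b by simp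
      \<comment> \<open>There is room for one more power of \<open>t\<close>, so removing one
        variable from \<open>a\<close> keeps \<open>b\<close> admissible.\<close>
      then have less: "(a, Suc b) \<in> simis_monoid C"
        by (simp only: le_alpha0_parallelization_iff[OF C])
      obtain v where v: "Poly_Mapping.lookup a v \<noteq> 0"
        using \<open>a \<noteq> 0\<close> by (auto simp: poly_mapping_eq_iff fun_eq_iff)
      define a' where "a' = a - Poly_Mapping.single v 1"
      have a: "a = a' + Poly_Mapping.single v 1"
        using v
          by (intro poly_mapping_eqI) (auto simp: a'_def lookup_add lookup_minus lookup_single when_def)
      have "(a', b) \<in> simis_monoid C"
      proof -
        have "b \<le> set_degree S a'" if "minimal_vertex_cover C S" for S
        proof -
          have "Suc b \<le> set_degree S a" using less that by (simp add: simis_monoid_def)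
          then show ?thesis by (simp add: a split: if_splits)
        qed
        then show ?thesis by (simp add: simis_monoid_def)
      qed
      moreover have "(Poly_Mapping.single v 1, 0) \<in> simis_monoid C" by (simp add: simis_monoid_def)
      moreover have "(a, b) = (a', b) + (Poly_Mapping.single v 1, 0)" using a by simp
      ultimately have "(a', b) = 0 \<or> (Poly_Mapping.single v 1, 0) = (0 :: ('v \<Rightarrow>\<^sub>0 nat) \<times> nat)"
        by (rule irr)
      moreover have "Poly_Mapping.single v (1::nat) \<noteq> 0"
        by (metis lookup_single_eq lookup_zero one_neq_zero)
      \<comment> \<open>The variable split off must be all of \<open>a\<close>, but its covering
        number is 0 and leaves no room for \<open>Suc b\<close>.\<close>
      ultimately have "a = Poly_Mapping.single v 1" using a by (simp add: zero_prod_def)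
      then show False using less \<alpha>_single[of v] by (simp add: mem)
    qed
    moreover have "\<not> decomposable (parallelization C a)"
    proof
      assume "decomposable (parallelization C a)"
      then obtain a1 a2 where "a1 \<noteq> 0" "a2 \<noteq> 0" "a = a1 + a2"
        "alpha0 (parallelization C a) = alpha0 (parallelization C a1) + alpha0 (parallelization C a2)"
        unfolding decomposable_parallelization_iff[OF C] by blast
      then show False
        using irr[of "(a1, alpha0 (parallelization C a1))" "(a2, alpha0 (parallelization C a2))"]
          \<open>b = alpha0 (parallelization C a)\<close> by (simp add: mem zero_prod_def)
    qed
    ultimately show "x \<in> {(a, alpha0 (parallelization C a)) | a. a \<noteq> 0 \<and> \<not> decomposable (parallelization C a)}"
      using ab \<open>a \<noteq> 0\<close> by blast
  next
    fix x assume "x \<in> {(a, alpha0 (parallelization C a)) | a. a \<noteq> 0 \<and> \<not> decomposable (parallelization C a)}"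
    then obtain a
      where a: "x = (a, alpha0 (parallelization C a))" "a \<noteq> 0" "\<not> decomposable (parallelization C a)"
      by blast
    have "y = 0 \<or> z = 0" if "y \<in> simis_monoid C" "z \<in> simis_monoid C" "x = y + z" for y z
    proof (rule ccontr)
      assume yz: "\<not> (y = 0 \<or> z = 0)"
      obtain a1 b1 a2 b2 where y: "y = (a1, b1)" and z: "z = (a2, b2)" by (cases y, cases z)
      have "b1 \<le> alpha0 (parallelization C a1)" "b2 \<le> alpha0 (parallelization C a2)"
        using that(1,2) by (simp_all add: y z mem)
      moreover from this have "a1 \<noteq> 0" "a2 \<noteq> 0" using yz \<alpha>_0 by (auto simp: y z zero_prod_def)
      moreover have "a = a1 + a2 \<and> alpha0 (parallelization C a) = b1 + b2"
        using that(3) unfolding a(1) y z add_Pair prod.inject .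
      \<comment> \<open>Superadditivity forces \<open>b1\<close> and \<open>b2\<close> to be the
        covering numbers of \<open>a1\<close> and \<open>a2\<close>, so \<open>a1\<close> and
        \<open>a2\<close> decompose the parallelization.\<close>
      ultimately show False
        using a(3) \<alpha>_add[of a1 a2] unfolding decomposable_parallelization_iff[OF C]
        by (metis add_mono le_antisym)
    qed
    moreover have "x \<in> simis_monoid C" by (simp add: a(1) mem)
    ultimately show "x \<in> irreducibles (simis_monoid C)"
      using a(1,2) by (auto simp: irreducibles_def zero_prod_def)
  qed
qed

theorem corollary3p2:
  fixes C :: "'v::finite clutter"
    and I :: "('v, 'k::field) mpoly set"
    and H :: "((real ^ 'v) \<times> real) set"
  assumes "is_clutter C" and "verts C = UNIV"
    and "I = edge_ideal C"
    and "H = hilbert_basis (simis_cone C)"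
  shows "H = {lattice_point a b | a b. xt_monomial a b \<in> minimal_generators (symbolic_Rees_algebra I)}
    \<and> ((\<forall>e\<in>edges C. card e \<ge> 2) \<longrightarrow>
         H = {lattice_point a (alpha0 (parallelization C a)) | a.
                a \<noteq> 0 \<and> \<not> decomposable (parallelization C a)})
    \<and> symbolic_Rees_algebra I = semigroup_ring (nat_span H)"
proof (intro conjI impI)
  let ?M = "simis_monoid C"
  have H: "H = lattice_map ` irreducibles ?M"
    using assms(4) by (simp add: hilbert_basis_simis_cone)
  have Rees: "symbolic_Rees_algebra I = K_vs.span (exponent_monomial ` ?M)"
    using assms(2,3) by (simp add: symbolic_Rees_algebra_edge_ideal)
  have gens: "minimal_generators (symbolic_Rees_algebra I) = exponent_monomial ` irreducibles ?M"
    unfolding Rees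
    by (intro minimal_generators_span_monomials finite_irreducibles_simis_monoid add_closure_irreducibles_simis_monoid)
  have gen_iff: "xt_monomial a b \<in> minimal_generators (symbolic_Rees_algebra I) \<longleftrightarrow> (a, b) \<in> irreducibles ?M" for a b
    unfolding gens by (force simp: xt_monomial_eq_iff)
  show "H = {lattice_point a b | a b. xt_monomial a b \<in> minimal_generators (symbolic_Rees_algebra I)}"
    unfolding gen_iff H by force
  show "H = {lattice_point a (alpha0 (parallelization C a)) | a. a \<noteq> 0 \<and> \<not> decomposable (parallelization C a)}"
    if "\<forall>e\<in>edges C. card e \<ge> 2"
    unfolding H irreducibles_simis_monoid[OF assms(1,2) that] by force
  \<comment> \<open>The semigroup ring is thereby spanned by the monomials with exponents in
    \<open>?M\<close>, just as the symbolic Rees algebra is.\<close>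
  have "nat_span H = lattice_map ` ?M"
    unfolding H using finite_irreducibles_simis_monoid[of C]
    by (simp add: nat_span_eq_add_closure add_closure_image[of lattice_map, OF lattice_map_zero lattice_map_add]
        add_closure_irreducibles_simis_monoid)
  then have "lattice_point a b \<in> nat_span H \<longleftrightarrow> (a, b) \<in> ?M" for a b
    using inj_image_mem_iff[OF inj_lattice_map, of "(a, b)" ?M] by simp
  then have "{xt_monomial a b | a b. lattice_point a b \<in> nat_span H} =
      (exponent_monomial ` ?M :: ('v, 'k) mpoly poly set)"
    by force
  then show "symbolic_Rees_algebra I = semigroup_ring (nat_span H)"
    by (simp add: semigroup_ring_def Rees)
qed

end
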